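(* Let $F$ be a Banach lattice with order continuous norm. If $F$ fails to have the positive Schur property, then there exists a reflexive Banach lattice $E$ such that the pair $(E,F)$ does not have the positive weak maximizing property.
   Context: Banach lattices are real; $S_E$ denotes the unit sphere of $E$. A Banach lattice has the positive Schur property if every weakly null sequence of positive elements in it is norm null. An operator $T:E\to F$ is norm-attaining if there is $x\in E$ with $\|x\|\le 1$ and $\|T(x)\|=\|T\|$. A maximizing sequence for a bounded linear operator $T:E\to F$ is a sequence $(x_n)_n\subset S_E$ with $\lim_{n\to\infty}\|T(x_n)\|=\|T\|$; it is positive if every $x_n\ge 0$, and non-weakly null if it does not converge weakly to $0$. A pair of Banach lattices $(E,F)$ has the positive weak maximizing property ($WMP^+$) if every positive operator $T:E\to F$ for which there exists a positive non-weakly null maximizing sequence is norm-attaining. *)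

theory Defs
  imports "HOL-Analysis.Analysis" "HOL-Library.Function_Algebras"
begin

section \<open>Pointwise real vector space structure on functions\<close>

instantiation "fun" :: (type, real_vector) real_vector
begin

definition scaleR_fun :: "real \<Rightarrow> ('a \<Rightarrow> 'b) \<Rightarrow> 'a \<Rightarrow> 'b"
  where "scaleR_fun c f = (\<lambda>x. c *\<^sub>R f x)"

instance
  by standard (auto simp: scaleR_fun_def fun_eq_iff scaleR_right_distrib scaleR_left_distrib)

end

section \<open>Banach lattices as types\<close>

text \<open>In a vector lattice the modulus of \<open>x\<close> is \<open>sup x (- x)\<close>.\<close>

class banach_lattice = banach + lattice + ordered_real_vector +
  assumes norm_mono_modulus: "sup x (- x) \<le> sup y (- y) \<Longrightarrow> norm x \<le> norm y"

text \<open>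
  Order continuity of the norm: for every net decreasing to \<open>0\<close> the norms tend to \<open>0\<close>.
  A decreasing net is replaced by its range, a nonempty downward directed set regarded as a net
  indexed by itself; this loses no generality because the norm is monotone on the positive cone.
\<close>

definition order_continuous_norm :: "'f::banach_lattice itself \<Rightarrow> bool"
  where "order_continuous_norm _ \<longleftrightarrow>
    (\<forall>D::'f set. D \<noteq> {} \<longrightarrow>
       (\<forall>x\<in>D. \<forall>y\<in>D. \<exists>z\<in>D. z \<le> x \<and> z \<le> y) \<longrightarrow>
       (\<forall>x\<in>D. 0 \<le> x) \<longrightarrow> (\<forall>l. (\<forall>x\<in>D. l \<le> x) \<longrightarrow> l \<le> 0) \<longrightarrow>
       (\<forall>\<epsilon>>0. \<exists>x\<in>D. \<forall>y\<in>D. y \<le> x \<longrightarrow> norm y < \<epsilon>))"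

definition weakly_null :: "(nat \<Rightarrow> 'f::real_normed_vector) \<Rightarrow> bool"
  where "weakly_null x \<longleftrightarrow> (\<forall>\<phi>::'f \<Rightarrow>\<^sub>L real. (\<lambda>n. blinfun_apply \<phi> (x n)) \<longlonglongrightarrow> 0)"

definition positive_Schur_property :: "'f::banach_lattice itself \<Rightarrow> bool"
  where "positive_Schur_property _ \<longleftrightarrow>
    (\<forall>x::nat \<Rightarrow> 'f. (\<forall>n. 0 \<le> x n) \<longrightarrow> weakly_null x \<longrightarrow> x \<longlonglongrightarrow> 0)"

section \<open>Normed spaces and Banach lattices on a carrier\<close>

text \<open>
  A Banach lattice that has to be produced by an existential statement cannot be a type, so it is
  a linear subspace of an ambient real vector space together with a norm and an order. The norm is
  only meaningful on the carrier. Every separable Banach space embeds linearly in \<open>nat \<Rightarrow> real\<close>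
  (its algebraic dimension is at most the continuum), so it occurs, up to isomorphism, as such a
  structure with ambient space \<open>nat \<Rightarrow> real\<close>.
\<close>

record 'a nspace =
  carr :: "'a set"
  nrm :: "'a \<Rightarrow> real"

record 'a nlattice = "'a nspace" +
  leq :: "('a \<times> 'a) set"

locale normed_space_on =
  fixes X :: "('a::real_vector, 'z) nspace_scheme"
  assumes subspace_carr: "subspace (carr X)"
    and nrm_nonneg: "x \<in> carr X \<Longrightarrow> 0 \<le> nrm X x"
    and nrm_eq_0_iff: "x \<in> carr X \<Longrightarrow> nrm X x = 0 \<longleftrightarrow> x = 0"
    and nrm_triangle: "x \<in> carr X \<Longrightarrow> y \<in> carr X \<Longrightarrow> nrm X (x + y) \<le> nrm X x + nrm X y"
    and nrm_scaleR: "x \<in> carr X \<Longrightarrow> nrm X (c *\<^sub>R x) = \<bar>c\<bar> * nrm X x"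

locale banach_space_on = normed_space_on +
  assumes complete_carr:
    "(\<And>n. x n \<in> carr X) \<Longrightarrow>
     (\<And>\<epsilon>. 0 < \<epsilon> \<Longrightarrow> \<exists>N. \<forall>m\<ge>N. \<forall>n\<ge>N. nrm X (x m - x n) < \<epsilon>) \<Longrightarrow>
     \<exists>l\<in>carr X. (\<lambda>n. nrm X (x n - l)) \<longlonglongrightarrow> 0"

definition is_sup_on :: "'a set \<Rightarrow> ('a \<times> 'a) set \<Rightarrow> 'a \<Rightarrow> 'a \<Rightarrow> 'a \<Rightarrow> bool"
  where "is_sup_on A r x y s \<longleftrightarrow>
    s \<in> A \<and> (x, s) \<in> r \<and> (y, s) \<in> r \<and> (\<forall>u\<in>A. (x, u) \<in> r \<longrightarrow> (y, u) \<in> r \<longrightarrow> (s, u) \<in> r)"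

text \<open>Binary infima are not required separately, since \<open>inf x y = - sup (- x) (- y)\<close>.\<close>

locale banach_lattice_on = banach_space_on E
  for E :: "'a::real_vector nlattice" +
  assumes partial_order: "partial_order_on (carr E) (leq E)"
    and ord_add: "(x, y) \<in> leq E \<Longrightarrow> z \<in> carr E \<Longrightarrow> (x + z, y + z) \<in> leq E"
    and ord_scaleR: "(x, y) \<in> leq E \<Longrightarrow> 0 \<le> c \<Longrightarrow> (c *\<^sub>R x, c *\<^sub>R y) \<in> leq E"
    and ex_sup: "x \<in> carr E \<Longrightarrow> y \<in> carr E \<Longrightarrow> \<exists>s. is_sup_on (carr E) (leq E) x y s"
    and nrm_mono_modulus:
      "x \<in> carr E \<Longrightarrow> y \<in> carr E \<Longrightarrow>
       is_sup_on (carr E) (leq E) x (- x) u \<Longrightarrow> is_sup_on (carr E) (leq E) y (- y) v \<Longrightarrow>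
       (u, v) \<in> leq E \<Longrightarrow> nrm E x \<le> nrm E y"

section \<open>Operators, duals and reflexivity\<close>

definition bounded_linear_on ::
    "('a::real_vector, 'z) nspace_scheme \<Rightarrow> ('a \<Rightarrow> 'b::real_normed_vector) \<Rightarrow> bool"
  where "bounded_linear_on X T \<longleftrightarrow>
    (\<forall>x\<in>carr X. \<forall>y\<in>carr X. T (x + y) = T x + T y) \<and>
    (\<forall>c. \<forall>x\<in>carr X. T (c *\<^sub>R x) = c *\<^sub>R T x) \<and>
    (\<exists>K. \<forall>x\<in>carr X. norm (T x) \<le> K * nrm X x)"

definition opnorm ::
    "('a::real_vector, 'z) nspace_scheme \<Rightarrow> ('a \<Rightarrow> 'b::real_normed_vector) \<Rightarrow> real"
  where "opnorm X T = (SUP x\<in>{x \<in> carr X. nrm X x \<le> 1}. norm (T x))"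

text \<open>
  Functionals are normalised to vanish off the carrier, so that each functional on the carrier is
  represented by exactly one function and the dual is again a normed space on a carrier.
\<close>

definition dual :: "('a::real_vector, 'z) nspace_scheme \<Rightarrow> ('a \<Rightarrow> real) nspace"
  where "dual X =
    \<lparr>carr = {f. bounded_linear_on X f \<and> (\<forall>x. x \<notin> carr X \<longrightarrow> f x = 0)}, nrm = opnorm X\<rparr>"

text \<open>Surjectivity of the canonical map into the bidual.\<close>

definition reflexive_on :: "('a::real_vector, 'z) nspace_scheme \<Rightarrow> bool"
  where "reflexive_on X \<longleftrightarrow>
    (\<forall>\<Phi>\<in>carr (dual (dual X)). \<exists>x\<in>carr X. \<forall>f\<in>carr (dual X). \<Phi> f = f x)"

definition weakly_null_on :: "('a::real_vector, 'z) nspace_scheme \<Rightarrow> (nat \<Rightarrow> 'a) \<Rightarrow> bool"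
  where "weakly_null_on X x \<longleftrightarrow> (\<forall>f\<in>carr (dual X). (\<lambda>n. f (x n)) \<longlonglongrightarrow> 0)"

section \<open>The positive weak maximizing property\<close>

definition positive_operator_on ::
    "'a::real_vector nlattice \<Rightarrow> ('a \<Rightarrow> 'f::banach_lattice) \<Rightarrow> bool"
  where "positive_operator_on E T \<longleftrightarrow>
    bounded_linear_on E T \<and> (\<forall>x. (0, x) \<in> leq E \<longrightarrow> 0 \<le> T x)"

definition norm_attaining_on ::
    "('a::real_vector, 'z) nspace_scheme \<Rightarrow> ('a \<Rightarrow> 'b::real_normed_vector) \<Rightarrow> bool"
  where "norm_attaining_on X T \<longleftrightarrow>
    (\<exists>x\<in>carr X. nrm X x \<le> 1 \<and> norm (T x) = opnorm X T)"

definition maximizing_seq_on ::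
    "('a::real_vector, 'z) nspace_scheme \<Rightarrow> ('a \<Rightarrow> 'b::real_normed_vector) \<Rightarrow> (nat \<Rightarrow> 'a) \<Rightarrow> bool"
  where "maximizing_seq_on X T x \<longleftrightarrow>
    (\<forall>n. x n \<in> carr X \<and> nrm X (x n) = 1) \<and> (\<lambda>n. norm (T (x n))) \<longlonglongrightarrow> opnorm X T"

definition positive_WMP :: "'a::real_vector nlattice \<Rightarrow> 'f::banach_lattice itself \<Rightarrow> bool"
  where "positive_WMP E _ \<longleftrightarrow>
    (\<forall>T::'a \<Rightarrow> 'f. positive_operator_on E T \<longrightarrow>
       (\<exists>x. maximizing_seq_on E T x \<and> (\<forall>n. (0, x n) \<in> leq E) \<and> \<not> weakly_null_on E x) \<longrightarrow>
       norm_attaining_on E T)"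

end

theory Submission
  imports Defs
begin

text \<open>
  The failure of the positive Schur property supplies positive vectors \<open>f 1, f 2, \<dots>\<close> of norm
  one that form a weakly null sequence; put \<open>f 0 = 0\<close>. The space \<open>E\<close> is a lattice of
  real sequences and the operator is \<open>T x = (\<Sum>n. x n *\<^sub>R f n)\<close>.

  Suppose first that \<open>\<parallel>\<cdot>\<parallel>\<close> is a reflexive lattice norm on the coordinates \<open>n \<ge> 1\<close> in which the unit
  sequences \<open>e n\<close> have norm at most one and both \<open>T\<close> and the coordinates are uniformly bounded. Then \<open>E\<close>
  can be given the norm that is the maximum of \<open>\<bar>x 0\<bar>\<close>, \<open>\<parallel>x\<parallel>\<close> and
  \<open>\<parallel>T \<bar>x\<bar>\<parallel> + (\<Sum>n\<ge>1. \<bar>x n\<bar> / 2 ^ n)\<close>. The last entry makes \<open>\<parallel>T x\<parallel>\<close> strictly smaller than the new norm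
  as soon as some \<open>x n\<close> with \<open>n \<ge> 1\<close> is nonzero, whereas \<open>T\<close> vanishes on \<open>e 0\<close>. So \<open>T\<close> does not attain
  its norm, which is \<open>1\<close>: the vectors \<open>e 0 + c *\<^sub>R e n\<close>, with \<open>c\<close> slightly below \<open>1\<close>, are a positive
  maximizing sequence, and the coordinate \<open>0\<close> shows that it is not weakly null.

  It remains to find the reflexive norm. With \<open>\<phi>\<close> ranging over the positive part of the dual unit
  ball, let \<open>p k x\<close> be the supremum of \<open>\<Sum>n. min 1 (4 ^ k * \<phi> (f n)) * \<bar>x n\<bar>\<close>, and let \<open>\<parallel>x\<parallel>\<close> be the
  \<open>\<ell>\<^sub>2\<close>-norm of the numbers \<open>p k x / 2 ^ Suc k\<close>. A sequence lattice whose norm is determined by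
  initial segments is reflexive once the tails of every bounded functional tend to \<open>0\<close> in norm
  (\<open>reflexive_on_seq_lattice\<close>). The tails of vectors tend to \<open>0\<close> because averages of functionals can be
  compared across levels (\<open>level_tail\<close>, \<open>mixed_tail\<close>). For the tails of functionals
  (\<open>functional_tail\<close>), weak nullity of \<open>f\<close> and a separation theorem that produces positive functionals
  (\<open>Mazur_Orlicz\<close>) provide vectors that are nearly orthogonal, in the \<open>\<ell>\<^sub>2\<close>-sum, to a given one and on
  which the functional is still large; the parallelogram-like estimate
  \<open>\<parallel>x + t y\<parallel>\<^sup>2 \<le> 1 + t\<^sup>2 + \<dots>\<close> then excludes this.
\<close>

section \<open>Linear functionals below a sublinear one\<close>

definition sublinear :: "('a::real_vector \<Rightarrow> real) \<Rightarrow> bool"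
  where "sublinear q \<longleftrightarrow>
    (\<forall>x y. q (x + y) \<le> q x + q y) \<and> (\<forall>c x. 0 \<le> c \<longrightarrow> q (c *\<^sub>R x) = c * q x)"

lemma sublinear_add: "sublinear q \<Longrightarrow> q (x + y) \<le> q x + q y"
  and sublinear_scale: "sublinear q \<Longrightarrow> 0 \<le> c \<Longrightarrow> q (c *\<^sub>R x) = c * q x"
  by (auto simp: sublinear_def)

lemma sublinear_zero: "sublinear q \<Longrightarrow> q 0 = 0"
  using sublinear_scale[of q 0 0] by simp

lemma sublinear_minus: "sublinear q \<Longrightarrow> - q (- x) \<le> q x"
  using sublinear_add[of q x "- x"] sublinear_zero[of q] by simp

lemma sublinearI:
  assumes add: "\<And>x y. q (x + y) \<le> q x + q y"
    and zero: "q 0 = 0"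
    and scale: "\<And>c x. 0 < c \<Longrightarrow> q (c *\<^sub>R x) \<le> c * q x"
  shows "sublinear q"
proof -
  have "q (c *\<^sub>R x) = c * q x" if "0 \<le> c" for c x
  proof (cases "c = 0")
    case False
    with that have c: "0 < c" by simp
    have "q (inverse c *\<^sub>R (c *\<^sub>R x)) \<le> inverse c * q (c *\<^sub>R x)"
      using c by (intro scale) simp
    then have "c * q x \<le> q (c *\<^sub>R x)"
      using c by (simp add: field_simps)
    with scale[OF c, of x] show ?thesis by simp
  qed (simp add: zero)
  then show ?thesis using add by (simp add: sublinear_def)
qed

text \<open>
  The proof constructs the largest such \<open>p\<close>, an infimum of shifted copies of \<open>q\<close>; convexity of
  \<open>D\<close> is what makes this infimum subadditive. The lemma serves twice: for a singleton
  \<open>D\<close> it shows that minimal sublinear functionals are linear, and for a general \<open>D\<close> it reduces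
  separation of \<open>D\<close> to plain domination.
\<close>

lemma sublinear_lowering:
  assumes q: "sublinear q" and D: "convex D" "D \<noteq> {}" and ge: "\<And>d. d \<in> D \<Longrightarrow> \<beta> \<le> q d"
  obtains p where "sublinear p" "\<And>x. p x \<le> q x" "\<And>d. d \<in> D \<Longrightarrow> p (- d) \<le> - \<beta>"
proof -
  define V where "V x = {q (x + t *\<^sub>R d) - t * \<beta> | t d. 0 \<le> t \<and> d \<in> D}" for x
  define p where "p x = Inf (V x)" for x
  have low: "- q (- x) \<le> v" if "v \<in> V x" for x v
  proof -
    from that obtain t d where v: "v = q (x + t *\<^sub>R d) - t * \<beta>" "0 \<le> t" "d \<in> D"
      by (auto simp: V_def)
    have "t * \<beta> \<le> q (t *\<^sub>R d)"
      using ge[OF v(3)] v(2) by (simp add: sublinear_scale[OF q] mult_left_mono)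
    also have "\<dots> \<le> q (x + t *\<^sub>R d) + q (- x)"
      using sublinear_add[OF q, of "x + t *\<^sub>R d" "- x"] by simp
    finally show ?thesis using v(1) by simp
  qed
  then have bdd: "bdd_below (V x)" for x by (meson bdd_belowI)
  obtain d0 where d0: "d0 \<in> D" using D by blast
  have qV: "q x \<in> V x" for x
    unfolding V_def using d0 by (intro CollectI exI[of _ 0] exI[of _ d0]) simp
  then have ne: "V x \<noteq> {}" for x by blast
  have le: "p x \<le> v" if "v \<in> V x" for x v
    unfolding p_def using that bdd by (rule cInf_lower)
  have le_at: "p x \<le> q (x + t *\<^sub>R d) - t * \<beta>" if "0 \<le> t" "d \<in> D" for x t d
    using that unfolding V_def by (intro le[unfolded V_def] CollectI exI[of _ t] exI[of _ d]) simp
  have add: "p (x + y) \<le> p x + p y" for x y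
  proof -
    have *: "p (x + y) \<le> v + w" if vw: "v \<in> V x" "w \<in> V y" for v w
    proof -
      from vw obtain t d s e where v: "v = q (x + t *\<^sub>R d) - t * \<beta>" "0 \<le> t" "d \<in> D"
        and w: "w = q (y + s *\<^sub>R e) - s * \<beta>" "0 \<le> s" "e \<in> D"
        by (auto simp: V_def)
      have "\<exists>h\<in>D. t *\<^sub>R d + s *\<^sub>R e = (t + s) *\<^sub>R h"
      proof (cases "t + s = 0")
        case True
        then have "t = 0" "s = 0" using v(2) w(2) by linarith+
        then show ?thesis using d0 by auto
      next
        case False
        then have pos: "0 < t + s" using v w by linarith
        have "(t / (t + s)) *\<^sub>R d + (s / (t + s)) *\<^sub>R e \<in> D"
          using pos v w by (intro convexD[OF D(1)]) (auto simp: add_divide_distrib[symmetric])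
        then show ?thesis
          using pos by (intro bexI) (auto simp: scaleR_right_distrib)
      qed
      then obtain h where h: "h \<in> D" "t *\<^sub>R d + s *\<^sub>R e = (t + s) *\<^sub>R h" by blast
      have "p (x + y) \<le> q ((x + y) + (t + s) *\<^sub>R h) - (t + s) * \<beta>"
        using h v w by (intro le_at) simp_all
      also have "(x + y) + (t + s) *\<^sub>R h = (x + t *\<^sub>R d) + (y + s *\<^sub>R e)"
        using h(2) by (simp add: algebra_simps)
      also have "q \<dots> - (t + s) * \<beta> \<le> v + w"
        using sublinear_add[OF q, of "x + t *\<^sub>R d" "y + s *\<^sub>R e"] v(1) w(1)
        by (simp add: algebra_simps)
      finally show ?thesis .
    qed
    have "p (x + y) - w \<le> p x" if "w \<in> V y" for w
      unfolding p_def[of x] using ne *[OF _ that] by (intro cInf_greatest) (auto simp: algebra_simps)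
    then have "p (x + y) - p x \<le> p y"
      unfolding p_def[of y] using ne by (intro cInf_greatest) (auto simp: algebra_simps)
    then show ?thesis by simp
  qed
  have "- q (- 0) \<le> p 0"
    unfolding p_def by (rule cInf_greatest[OF ne low])
  then have "p 0 = 0"
    using le[OF qV, of 0] sublinear_zero[OF q] by simp
  moreover have "p (c *\<^sub>R x) \<le> c * p x" if c: "0 < c" for c x
  proof -
    have "p (c *\<^sub>R x) / c \<le> v" if "v \<in> V x" for v
    proof -
      from that obtain t d where v: "v = q (x + t *\<^sub>R d) - t * \<beta>" "0 \<le> t" "d \<in> D"
        by (auto simp: V_def)
      have "p (c *\<^sub>R x) \<le> q (c *\<^sub>R x + (c * t) *\<^sub>R d) - (c * t) * \<beta>"
        using v c by (intro le_at) simp_all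
      also have "c *\<^sub>R x + (c * t) *\<^sub>R d = c *\<^sub>R (x + t *\<^sub>R d)"
        by (simp add: scaleR_right_distrib)
      also have "q \<dots> - (c * t) * \<beta> = c * v"
        unfolding v(1) using c by (simp only: sublinear_scale[OF q less_imp_le] right_diff_distrib mult.assoc)
      finally show ?thesis using c by (simp add: field_simps)
    qed
    then have "p (c *\<^sub>R x) / c \<le> p x"
      unfolding p_def[of x] using ne by (intro cInf_greatest)
    then show ?thesis using c by (simp add: field_simps)
  qed
  ultimately have "sublinear p" using add by (intro sublinearI) auto
  moreover have "p (- d) \<le> - \<beta>" if "d \<in> D" for d
    using le_at[of 1 d "- d"] that sublinear_zero[OF q] by simp
  ultimately show thesis using that le[OF qV] by blast
qed

text \<open>
  By Zorn's lemma there is a minimal sublinear functional below \<open>q\<close>. Lowering it at any point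
  changes nothing, which forces it to be odd, and an odd sublinear functional is linear.
\<close>

lemma Hahn_Banach_sublinear:
  fixes q :: "'a::real_vector \<Rightarrow> real"
  assumes q: "sublinear q"
  obtains \<phi> where "linear \<phi>" "\<And>x. \<phi> x \<le> q x"
proof -
  define A where "A = {p. sublinear p \<and> p \<le> q}"
  have "\<exists>m\<in>A. \<forall>a\<in>A. a \<le> m \<longrightarrow> a = m"
  proof (rule predicate_Zorn)
    show "partial_order_on A (relation_of (\<lambda>a b. b \<le> a) A)"
      by (rule partial_order_on_relation_ofI) auto
    fix C assume C: "C \<in> Chains (relation_of (\<lambda>a b. b \<le> a) A)"
    then have CA: "C \<subseteq> A" and tot: "\<And>a b. a \<in> C \<Longrightarrow> b \<in> C \<Longrightarrow> a \<le> b \<or> b \<le> a"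
      by (auto simp: Chains_def relation_of_def)
    show "\<exists>u\<in>A. \<forall>a\<in>C. u \<le> a"
    proof (cases "C = {}")
      case True
      then show ?thesis using q by (auto simp: A_def)
    next
      case False
      define u where "u x = (INF a\<in>C. a x)" for x
      have low: "- q (- x) \<le> a x" if "a \<in> C" for a x
      proof -
        have "sublinear a" "a (- x) \<le> q (- x)" using that CA by (auto simp: A_def le_fun_def)
        then show ?thesis using sublinear_minus[of a x] by linarith
      qed
      then have bdd: "bdd_below ((\<lambda>a. a x) ` C)" for x by (auto intro!: bdd_belowI)
      have le: "u x \<le> a x" if "a \<in> C" for a x
        unfolding u_def using that bdd by (intro cINF_lower)
      have sub: "sublinear a" if "a \<in> C" for a using that CA by (auto simp: A_def)
      have "u (x + y) \<le> u x + u y" for x y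
      proof -
        have *: "u (x + y) \<le> a x + b y" if "a \<in> C" "b \<in> C" for a b
        proof (cases "a \<le> b")
          case True
          then show ?thesis
            using le[OF that(1), of "x + y"] sublinear_add[OF sub[OF that(1)], of x y]
            by (auto simp: le_fun_def intro: order_trans)
        next
          case False
          then have "b \<le> a" using tot that by blast
          then have "b x \<le> a x" by (simp add: le_fun_def)
          then show ?thesis
            using le[OF that(2), of "x + y"] sublinear_add[OF sub[OF that(2)], of x y] by linarith
        qed
        have "u (x + y) - b y \<le> u x" if "b \<in> C" for b
          unfolding u_def[of x] using False *[OF _ that]
          by (intro cINF_greatest) (auto simp: algebra_simps)
        then have "u (x + y) - u x \<le> u y"
          unfolding u_def[of y] using False by (intro cINF_greatest) (auto simp: algebra_simps)
        then show ?thesis by simp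
      qed
      moreover have "u 0 = 0"
        using False sub by (simp add: u_def sublinear_zero cong: INF_cong)
      moreover have "u (c *\<^sub>R x) \<le> c * u x" if "0 < c" for c x
      proof -
        have "u (c *\<^sub>R x) / c \<le> u x"
          unfolding u_def[of x]
        proof (rule cINF_greatest[OF False])
          fix a assume a: "a \<in> C"
          show "u (c *\<^sub>R x) / c \<le> a x"
            using le[OF a, of "c *\<^sub>R x"] sublinear_scale[OF sub[OF a], of c x] that
            by (simp add: field_simps)
        qed
        then show ?thesis using that by (simp add: field_simps)
      qed
      ultimately have "sublinear u" by (rule sublinearI)
      moreover have "u \<le> q"
      proof (rule le_funI)
        fix x
        obtain a where a: "a \<in> C" using False by blast
        then have "a x \<le> q x" using CA by (auto simp: A_def le_fun_def)
        with le[OF a, of x] show "u x \<le> q x" by simp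
      qed
      ultimately show ?thesis using le by (auto simp: A_def le_fun_def)
    qed
  qed
  then obtain p where p: "sublinear p" "p \<le> q" and min: "\<And>a. sublinear a \<Longrightarrow> a \<le> p \<Longrightarrow> a = p"
    by (auto simp: A_def intro: order_trans)
  have neg: "p (- y) = - p y" for y
  proof -
    obtain a where a: "sublinear a" "\<And>x. a x \<le> p x" "\<And>d. d \<in> {y} \<Longrightarrow> a (- d) \<le> - p y"
      by (rule sublinear_lowering[OF p(1), of "{y}" "p y"]) auto
    have "a = p" using a by (intro min) (auto simp: le_fun_def)
    with a(3)[of y] sublinear_minus[OF p(1), of "- y"] show ?thesis by simp
  qed
  have "linear p"
  proof (rule linearI)
    fix x y
    have "p x \<le> p (x + y) + p (- y)"
      using sublinear_add[OF p(1), of "x + y" "- y"] by simp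
    then show "p (x + y) = p x + p y"
      using sublinear_add[OF p(1), of x y] neg[of y] by simp
  next
    fix c x
    show "p (c *\<^sub>R x) = c *\<^sub>R p x"
    proof (cases "0 \<le> c")
      case False
      then have "p ((- c) *\<^sub>R x) = (- c) * p x" by (intro sublinear_scale[OF p(1)]) simp
      then show ?thesis using neg[of "c *\<^sub>R x"] by simp
    qed (simp add: sublinear_scale[OF p(1)])
  qed
  then show thesis using that p(2) by (auto simp: le_fun_def)
qed

text \<open>
  Separation with a one-sided bound: applied to \<open>q x = norm (sup x 0)\<close> it yields positive
  functionals, which the separating functionals of the usual theorem need not be.
\<close>

lemma Mazur_Orlicz:
  fixes q :: "'a::real_vector \<Rightarrow> real"
  assumes "sublinear q" "convex D" "D \<noteq> {}" "\<And>d. d \<in> D \<Longrightarrow> \<beta> \<le> q d"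
  obtains \<phi> where "linear \<phi>" "\<And>x. \<phi> x \<le> q x" "\<And>d. d \<in> D \<Longrightarrow> \<beta> \<le> \<phi> d"
proof -
  obtain p where p: "sublinear p" "\<And>x. p x \<le> q x" "\<And>d. d \<in> D \<Longrightarrow> p (- d) \<le> - \<beta>"
    using sublinear_lowering[OF assms] by blast
  obtain \<phi> where \<phi>: "linear \<phi>" "\<And>x. \<phi> x \<le> p x" using Hahn_Banach_sublinear[OF p(1)] by blast
  have "\<beta> \<le> \<phi> d" if "d \<in> D" for d
    using order_trans[OF \<phi>(2) p(3)[OF that]] linear_neg[OF \<phi>(1), of d] by simp
  then show thesis using that \<phi> p(2) order_trans by meson
qed

section \<open>Sequence lattices from seminorms of initial segments\<close>

definition cutoff :: "nat \<Rightarrow> (nat \<Rightarrow> real) \<Rightarrow> nat \<Rightarrow> real"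
  where "cutoff m x = (\<lambda>n. if n < m then x n else 0)"

definition unit_seq :: "nat \<Rightarrow> nat \<Rightarrow> real"
  where "unit_seq n = (\<lambda>i. if i = n then 1 else 0)"

lemma scaleR_fun_apply [simp]: "(c *\<^sub>R f) x = c *\<^sub>R f x"
  by (simp add: scaleR_fun_def)

lemma cutoff_apply: "cutoff m x n = (if n < m then x n else 0)"
  by (simp add: cutoff_def)

lemma cutoff_Suc: "cutoff (Suc m) x = cutoff m x + x m *\<^sub>R unit_seq m"
  by (auto simp: fun_eq_iff cutoff_def unit_seq_def less_Suc_eq)

lemma cutoff_0: "cutoff 0 x = 0"
  by (simp add: cutoff_def zero_fun_def)

lemma linear_cutoff:
  fixes f :: "(nat \<Rightarrow> real) \<Rightarrow> real"
  assumes "linear f"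
  shows "f (cutoff m x) = (\<Sum>n<m. x n * f (unit_seq n))"
proof -
  have step: "f (cutoff (Suc m) x) = f (cutoff m x) + x m * f (unit_seq m)" for m
    by (simp add: cutoff_Suc linear_add[OF assms] linear_scale[OF assms])
  have "f (cutoff 0 x) = 0" by (simp add: cutoff_0 linear_0[OF assms])
  then show ?thesis by (induction m) (simp_all add: step)
qed

text \<open>
  \<open>r m\<close> measures the first \<open>m\<close> coordinates of a sequence. The norm of a sequence is the supremum
  of all \<open>r m\<close>; it therefore has the Fatou property, which gives both completeness and, in the
  proof of reflexivity, the membership of a sequence in the space from bounds on its initial
  segments.
\<close>

locale lattice_seminorms =
  fixes r :: "nat \<Rightarrow> (nat \<Rightarrow> real) \<Rightarrow> real" and C :: "nat \<Rightarrow> real"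
  assumes triangle: "r m (x + y) \<le> r m x + r m y"
    and scale: "r m (c *\<^sub>R x) = \<bar>c\<bar> * r m x"
    and mono: "(\<And>n. n < m \<Longrightarrow> \<bar>x n\<bar> \<le> \<bar>y n\<bar>) \<Longrightarrow> r m x \<le> r m y"
    and r_cutoff: "j \<le> m \<Longrightarrow> r m (cutoff j x) = r j x"
    and coordinate_le: "n < m \<Longrightarrow> \<bar>x n\<bar> \<le> C n * r m x"
begin

definition bounded_seqs :: "(nat \<Rightarrow> real) set"
  where "bounded_seqs = {x. bdd_above (range (\<lambda>m. r m x))}"

definition seq_norm :: "(nat \<Rightarrow> real) \<Rightarrow> real"
  where "seq_norm x = (SUP m. r m x)"

definition seq_lattice :: "(nat \<Rightarrow> real) nlattice"
  where "seq_lattice = \<lparr>carr = bounded_seqs, nrm = seq_norm,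
    leq = {(x, y). x \<in> bounded_seqs \<and> y \<in> bounded_seqs \<and> (\<forall>n. x n \<le> y n)}\<rparr>"

lemma seq_lattice_simps [simp]:
  "carr seq_lattice = bounded_seqs" "nrm seq_lattice = seq_norm"
  "(x, y) \<in> leq seq_lattice \<longleftrightarrow> x \<in> bounded_seqs \<and> y \<in> bounded_seqs \<and> (\<forall>n. x n \<le> y n)"
  by (auto simp: seq_lattice_def)

lemma r_zero [simp]: "r m 0 = 0"
  using scale[of m 0 0] by simp

lemma r_nonneg: "0 \<le> r m x"
  using mono[of m 0 x] by simp

lemma r_uminus: "r m (- x) = r m x"
  using scale[of m "-1" x] by simp

lemma r_mono_index: "j \<le> m \<Longrightarrow> r j x \<le> r m x"
  using mono[of m "cutoff j x" x] r_cutoff[of j m x] by (simp add: cutoff_apply)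

lemma r_le_seq_norm: "x \<in> bounded_seqs \<Longrightarrow> r m x \<le> seq_norm x"
  unfolding seq_norm_def bounded_seqs_def by (auto intro: cSUP_upper)

lemma bounded_seqsI: "(\<And>m. r m x \<le> B) \<Longrightarrow> x \<in> bounded_seqs"
  unfolding bounded_seqs_def by (auto intro: bdd_aboveI[where M = B])

lemma seq_norm_le: "(\<And>m. r m x \<le> B) \<Longrightarrow> seq_norm x \<le> B"
  unfolding seq_norm_def by (auto intro: cSUP_least)

lemma seq_norm_nonneg: "x \<in> bounded_seqs \<Longrightarrow> 0 \<le> seq_norm x"
  using r_le_seq_norm r_nonneg order_trans by blast

lemma bounded_seqs_add: "x \<in> bounded_seqs \<Longrightarrow> y \<in> bounded_seqs \<Longrightarrow> x + y \<in> bounded_seqs"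
  by (rule bounded_seqsI[of _ "seq_norm x + seq_norm y"])
    (rule order_trans[OF triangle add_mono[OF r_le_seq_norm r_le_seq_norm]])

lemma bounded_seqs_scaleR: "x \<in> bounded_seqs \<Longrightarrow> c *\<^sub>R x \<in> bounded_seqs"
  by (rule bounded_seqsI[of _ "\<bar>c\<bar> * seq_norm x"])
    (auto simp: scale r_le_seq_norm intro: mult_left_mono)

lemma subspace_bounded_seqs: "subspace bounded_seqs"
  by (intro subspaceI bounded_seqs_add bounded_seqs_scaleR) (auto intro: bounded_seqsI[of _ 0])

lemma bounded_seqs_diff: "x \<in> bounded_seqs \<Longrightarrow> y \<in> bounded_seqs \<Longrightarrow> x - y \<in> bounded_seqs"
  by (rule subspace_diff[OF subspace_bounded_seqs])

lemma bounded_seqs_mono: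
  "y \<in> bounded_seqs \<Longrightarrow> (\<And>n. \<bar>x n\<bar> \<le> \<bar>y n\<bar>) \<Longrightarrow> x \<in> bounded_seqs"
  by (rule bounded_seqsI[of _ "seq_norm y"]) (rule order_trans[OF mono r_le_seq_norm])

lemma seq_norm_mono:
  "y \<in> bounded_seqs \<Longrightarrow> (\<And>n. \<bar>x n\<bar> \<le> \<bar>y n\<bar>) \<Longrightarrow> seq_norm x \<le> seq_norm y"
  by (rule seq_norm_le) (rule order_trans[OF mono r_le_seq_norm])

text \<open>For sequences that vanish from some index on, the supremum over \<open>m\<close> is already attained there.\<close>

lemma r_beyond: "(\<And>n. j \<le> n \<Longrightarrow> x n = 0) \<Longrightarrow> r m x \<le> r j x"
proof -
  assume *: "\<And>n. j \<le> n \<Longrightarrow> x n = 0"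
  then have x: "cutoff j x = x" by (auto simp: cutoff_def fun_eq_iff)
  have "r m x \<le> r (max m j) x" by (simp add: r_mono_index)
  also have "\<dots> = r j x" using r_cutoff[of j "max m j" x] by (simp add: x)
  finally show ?thesis .
qed

lemma seq_norm_beyond:
  assumes "\<And>n. j \<le> n \<Longrightarrow> x n = 0"
  shows "x \<in> bounded_seqs" "seq_norm x = r j x"
proof -
  show x: "x \<in> bounded_seqs" using r_beyond[of j x] assms by (intro bounded_seqsI) auto
  show "seq_norm x = r j x"
    using r_beyond[of j x] assms r_le_seq_norm[OF x, of j] by (intro antisym seq_norm_le) auto
qed

lemma cutoff_bounded_seqs: "cutoff m x \<in> bounded_seqs"
  by (rule seq_norm_beyond(1)[of m]) (simp add: cutoff_apply)

lemma unit_seq_bounded_seqs: "unit_seq m \<in> bounded_seqs"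
  by (rule seq_norm_beyond(1)[of "Suc m"]) (simp add: unit_seq_def)

lemma coordinate_le_norm: "x \<in> bounded_seqs \<Longrightarrow> \<bar>x n\<bar> \<le> \<bar>C n\<bar> * seq_norm x"
proof -
  assume x: "x \<in> bounded_seqs"
  have "\<bar>x n\<bar> \<le> C n * r (Suc n) x" by (rule coordinate_le) simp
  also have "\<dots> \<le> \<bar>C n\<bar> * r (Suc n) x" using r_nonneg by (intro mult_right_mono) auto
  also have "\<dots> \<le> \<bar>C n\<bar> * seq_norm x" using r_le_seq_norm[OF x] by (intro mult_left_mono) auto
  finally show ?thesis .
qed

lemma r_cutoff_le_sum: "r m (cutoff j x) \<le> (\<Sum>n<j. \<bar>x n\<bar> * r m (unit_seq n))"
proof -
  have step: "r m (cutoff (Suc j) x) \<le> r m (cutoff j x) + \<bar>x j\<bar> * r m (unit_seq j)" for j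
    using triangle[of m "cutoff j x" "x j *\<^sub>R unit_seq j"] by (simp add: cutoff_Suc scale)
  have "r m (cutoff 0 x) = 0" by (simp add: cutoff_0)
  then show ?thesis
  proof (induction j)
    case (Suc j)
    then show ?case using step[of j] by simp
  qed simp
qed

text \<open>
  Each \<open>r m\<close> lives on finitely many coordinates, where all that matters is coordinatewise
  convergence. This is how limits of Cauchy sequences are estimated one \<open>r m\<close> at a time.
\<close>

lemma r_coordinatewise_null:
  assumes "\<And>n. (\<lambda>j. z j n) \<longlonglongrightarrow> 0"
  shows "(\<lambda>j. r m (z j)) \<longlonglongrightarrow> 0"
proof (rule tendsto_sandwich)
  show "\<forall>\<^sub>F j in sequentially. 0 \<le> r m (z j)" by (simp add: r_nonneg)
  show "\<forall>\<^sub>F j in sequentially. r m (z j) \<le> (\<Sum>n<m. \<bar>z j n\<bar> * r m (unit_seq n))"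
    using r_cutoff_le_sum[of m m] by (simp add: r_cutoff)
  show "(\<lambda>j. \<Sum>n<m. \<bar>z j n\<bar> * r m (unit_seq n)) \<longlonglongrightarrow> 0"
    using assms by (intro tendsto_null_sum tendsto_mult_left_zero tendsto_rabs_zero)
qed simp

lemma seq_norm_complete:
  assumes x: "\<And>i. x i \<in> bounded_seqs"
    and Cauchy: "\<And>\<epsilon>. 0 < \<epsilon> \<Longrightarrow> \<exists>N. \<forall>i\<ge>N. \<forall>j\<ge>N. seq_norm (x i - x j) < \<epsilon>"
  shows "\<exists>l\<in>bounded_seqs. (\<lambda>i. seq_norm (x i - l)) \<longlonglongrightarrow> 0"
proof -
  have "convergent (\<lambda>i. x i n)" for n
  proof -
    have "Cauchy (\<lambda>i. x i n)"
    proof (rule metric_CauchyI)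
      fix e :: real assume e: "0 < e"
      then obtain N where N: "\<forall>i\<ge>N. \<forall>j\<ge>N. seq_norm (x i - x j) < e / (\<bar>C n\<bar> + 1)"
        using Cauchy[of "e / (\<bar>C n\<bar> + 1)"] by (meson abs_ge_zero add_nonneg_pos divide_pos_pos zero_less_one)
      have "dist (x i n) (x j n) < e" if "i \<ge> N" "j \<ge> N" for i j
      proof -
        have "\<bar>(x i - x j) n\<bar> \<le> \<bar>C n\<bar> * seq_norm (x i - x j)"
          by (intro coordinate_le_norm bounded_seqs_diff x)
        also have "\<dots> \<le> (\<bar>C n\<bar> + 1) * seq_norm (x i - x j)"
          by (intro mult_right_mono seq_norm_nonneg bounded_seqs_diff x) simp
        also have "\<dots> < e" using N that by (simp add: field_simps)
        finally show ?thesis by (simp add: dist_real_def)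
      qed
      then show "\<exists>N. \<forall>i\<ge>N. \<forall>j\<ge>N. dist (x i n) (x j n) < e" by blast
    qed
    then show ?thesis by (simp add: Cauchy_convergent_iff)
  qed
  then obtain l where l: "\<And>n. (\<lambda>i. x i n) \<longlonglongrightarrow> l n"
    unfolding convergent_def by metis
  have near: "\<exists>N. \<forall>i\<ge>N. \<forall>m. r m (x i - l) \<le> \<epsilon>" if \<epsilon>: "0 < \<epsilon>" for \<epsilon>
  proof -
    obtain N where N: "\<forall>i\<ge>N. \<forall>j\<ge>N. seq_norm (x i - x j) < \<epsilon>" using Cauchy[OF \<epsilon>] by blast
    have "r m (x i - l) \<le> \<epsilon>" if i: "i \<ge> N" for i m
    proof -
      have "(\<lambda>j. r m (x j - l)) \<longlonglongrightarrow> 0"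
        using l by (intro r_coordinatewise_null) (simp add: LIM_zero)
      then have "(\<lambda>j. \<epsilon> + r m (x j - l)) \<longlonglongrightarrow> \<epsilon> + 0" by (intro tendsto_intros)
      moreover have "r m (x i - l) \<le> \<epsilon> + r m (x j - l)" if "j \<ge> N" for j
        using triangle[of m "x i - x j" "x j - l"] N i that
          r_le_seq_norm[OF bounded_seqs_diff[OF x x], of m i j] by fastforce
      ultimately show ?thesis using LIMSEQ_le_const[of _ "\<epsilon> + 0" "r m (x i - l)"] by auto
    qed
    then show ?thesis by blast
  qed
  obtain N where "\<And>m. r m (x N - l) \<le> 1" using near[of 1] by auto
  then have "x N - l \<in> bounded_seqs" by (rule bounded_seqsI)
  then have "x N - (x N - l) \<in> bounded_seqs" by (rule bounded_seqs_diff[OF x])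
  moreover have "x N - (x N - l) = l" by (simp add: fun_eq_iff)
  ultimately have l_in: "l \<in> bounded_seqs" by metis
  have "(\<lambda>i. seq_norm (x i - l)) \<longlonglongrightarrow> 0"
  proof (rule LIMSEQ_I)
    fix e :: real assume "0 < e"
    then obtain N where N: "\<forall>i\<ge>N. \<forall>m. r m (x i - l) \<le> e / 2" using near[of "e / 2"] by auto
    have "norm (seq_norm (x i - l) - 0) < e" if "i \<ge> N" for i
      using seq_norm_le[of "x i - l" "e / 2"] N that \<open>0 < e\<close>
        seq_norm_nonneg[OF bounded_seqs_diff[OF x l_in], of i] by auto
    then show "\<exists>N. \<forall>i\<ge>N. norm (seq_norm (x i - l) - 0) < e" by blast
  qed
  then show ?thesis using l_in by blast
qed

lemma is_sup_on_modulus: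
  assumes x: "x \<in> bounded_seqs" and u: "is_sup_on (carr seq_lattice) (leq seq_lattice) x (- x) u"
  shows "u n = \<bar>x n\<bar>"
proof -
  have a: "(\<lambda>n. \<bar>x n\<bar>) \<in> bounded_seqs" by (rule bounded_seqs_mono[OF x]) simp
  have mx: "- x \<in> bounded_seqs" using bounded_seqs_scaleR[OF x, of "-1"] by simp
  from u have "(u, \<lambda>n. \<bar>x n\<bar>) \<in> leq seq_lattice"
    unfolding is_sup_on_def using a mx x by auto
  then have "u n \<le> \<bar>x n\<bar>" by simp
  moreover have "x n \<le> u n" "- x n \<le> u n" using u by (auto simp: is_sup_on_def)
  ultimately show ?thesis by linarith
qed

theorem banach_lattice_on_seq_lattice: "banach_lattice_on seq_lattice"
proof
  show "subspace (carr seq_lattice)" by (simp add: subspace_bounded_seqs)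
  show "0 \<le> nrm seq_lattice x" if "x \<in> carr seq_lattice" for x
    using that seq_norm_nonneg by simp
  show "(nrm seq_lattice x = 0) = (x = 0)" if "x \<in> carr seq_lattice" for x
  proof
    assume "nrm seq_lattice x = 0"
    then show "x = 0" using coordinate_le_norm[of x] that by (auto simp: fun_eq_iff)
  next
    show "x = 0 \<Longrightarrow> nrm seq_lattice x = 0" by (simp add: seq_norm_def)
  qed
  show "nrm seq_lattice (x + y) \<le> nrm seq_lattice x + nrm seq_lattice y"
    if "x \<in> carr seq_lattice" "y \<in> carr seq_lattice" for x y
    using that order_trans[OF triangle add_mono[OF r_le_seq_norm r_le_seq_norm]]
    by (auto intro: seq_norm_le)
  show "nrm seq_lattice (c *\<^sub>R x) = \<bar>c\<bar> * nrm seq_lattice x" if x: "x \<in> carr seq_lattice" for x c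
  proof -
    have le: "seq_norm (c *\<^sub>R x) \<le> \<bar>c\<bar> * seq_norm x" if "x \<in> bounded_seqs" for c x
      using that by (auto simp: scale r_le_seq_norm intro!: seq_norm_le mult_left_mono)
    show ?thesis
    proof (cases "c = 0")
      case True
      then show ?thesis by (simp add: seq_norm_def)
    next
      case False
      have "seq_norm (inverse c *\<^sub>R (c *\<^sub>R x)) \<le> \<bar>inverse c\<bar> * seq_norm (c *\<^sub>R x)"
        using x by (intro le bounded_seqs_scaleR) simp
      then have "\<bar>c\<bar> * seq_norm x \<le> seq_norm (c *\<^sub>R x)"
        using False by (simp add: abs_inverse field_simps)
      then show ?thesis using le[of x c] x by simp
    qed
  qed
  show "\<exists>l\<in>carr seq_lattice. (\<lambda>n. nrm seq_lattice (x n - l)) \<longlonglongrightarrow> 0"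
    if "\<And>n. x n \<in> carr seq_lattice"
      "\<And>\<epsilon>. 0 < \<epsilon> \<Longrightarrow> \<exists>N. \<forall>m\<ge>N. \<forall>n\<ge>N. nrm seq_lattice (x m - x n) < \<epsilon>" for x
    using seq_norm_complete[of x] that by simp
  show "partial_order_on (carr seq_lattice) (leq seq_lattice)"
    unfolding partial_order_on_def preorder_on_def refl_on_def trans_def antisym_def
    by (auto simp: fun_eq_iff intro: order_trans antisym)
  show "(x + z, y + z) \<in> leq seq_lattice"
    if "(x, y) \<in> leq seq_lattice" "z \<in> carr seq_lattice" for x y z
    using that by (auto intro: bounded_seqs_add)
  show "(c *\<^sub>R x, c *\<^sub>R y) \<in> leq seq_lattice" if "(x, y) \<in> leq seq_lattice" "0 \<le> c" for x y c
    using that by (auto intro: bounded_seqs_scaleR mult_left_mono)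
  show "\<exists>s. is_sup_on (carr seq_lattice) (leq seq_lattice) x y s"
    if x: "x \<in> carr seq_lattice" and y: "y \<in> carr seq_lattice" for x y
  proof -
    have abs: "(\<lambda>n. \<bar>x n\<bar>) \<in> bounded_seqs" "(\<lambda>n. \<bar>y n\<bar>) \<in> bounded_seqs"
      using x y by (auto intro: bounded_seqs_mono[of x] bounded_seqs_mono[of y])
    have "(\<lambda>n. max (x n) (y n)) \<in> bounded_seqs"
      by (rule bounded_seqs_mono[OF bounded_seqs_add[OF abs]]) auto
    then show ?thesis using x y by (intro exI[of _ "\<lambda>n. max (x n) (y n)"]) (auto simp: is_sup_on_def)
  qed
  show "nrm seq_lattice x \<le> nrm seq_lattice y"
    if x: "x \<in> carr seq_lattice" and y: "y \<in> carr seq_lattice"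
      and u: "is_sup_on (carr seq_lattice) (leq seq_lattice) x (- x) u"
      and v: "is_sup_on (carr seq_lattice) (leq seq_lattice) y (- y) v"
      and uv: "(u, v) \<in> leq seq_lattice" for x y u v
    using is_sup_on_modulus[OF _ u] is_sup_on_modulus[OF _ v] x y uv by (auto intro: seq_norm_mono)
qed

lemma dual_memI:
  assumes "linear f" "\<And>x. x \<in> bounded_seqs \<Longrightarrow> \<bar>f x\<bar> \<le> K * seq_norm x"
  shows "(\<lambda>x. if x \<in> bounded_seqs then f x else 0) \<in> carr (dual seq_lattice)"
  using assms
  by (auto simp: dual_def bounded_linear_on_def linear_add linear_scale bounded_seqs_add
      bounded_seqs_scaleR)

lemma opnorm_le:
  assumes "\<And>x. x \<in> bounded_seqs \<Longrightarrow> seq_norm x \<le> 1 \<Longrightarrow> norm (f x) \<le> K"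
  shows "opnorm seq_lattice f \<le> K"
proof -
  have "0 \<in> {x \<in> bounded_seqs. seq_norm x \<le> 1}"
    using seq_norm_le[of 0 0] by (auto intro: bounded_seqsI[of _ 0])
  then show ?thesis unfolding opnorm_def using assms by (auto intro!: cSUP_least)
qed

lemma le_opnorm:
  assumes "bounded_linear_on seq_lattice f" "x \<in> bounded_seqs" "seq_norm x \<le> 1"
  shows "norm (f x) \<le> opnorm seq_lattice f"
proof -
  obtain K where "\<forall>x\<in>bounded_seqs. norm (f x) \<le> K * seq_norm x"
    using assms(1) unfolding bounded_linear_on_def by auto
  then have K: "norm (f x) \<le> K * seq_norm x" if "x \<in> bounded_seqs" for x using that by blast
  have "norm (f x) \<le> \<bar>K\<bar>" if "x \<in> bounded_seqs" "seq_norm x \<le> 1" for x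
  proof -
    have "norm (f x) \<le> \<bar>K\<bar> * seq_norm x"
      using K[OF that(1)] mult_right_mono[OF abs_ge_self[of K] seq_norm_nonneg[OF that(1)]] by simp
    also have "\<dots> \<le> \<bar>K\<bar> * 1" using that by (intro mult_left_mono) auto
    finally show ?thesis by simp
  qed
  then show ?thesis unfolding opnorm_def using assms(2,3)
    by (intro cSUP_upper) (auto intro!: bdd_aboveI)
qed

lemma bounded_linear_on_cutoff:
  fixes f :: "(nat \<Rightarrow> real) \<Rightarrow> 'b::real_normed_vector"
  assumes "bounded_linear_on seq_lattice f"
  shows "f (cutoff m x) = (\<Sum>n<m. x n *\<^sub>R f (unit_seq n))"
proof -
  have add: "f (y + z) = f y + f z" if "y \<in> bounded_seqs" "z \<in> bounded_seqs" for y z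
    using assms that unfolding bounded_linear_on_def by auto
  have scl: "f (c *\<^sub>R y) = c *\<^sub>R f y" if "y \<in> bounded_seqs" for c y
    using assms that unfolding bounded_linear_on_def by auto
  have step: "f (cutoff (Suc m) x) = f (cutoff m x) + x m *\<^sub>R f (unit_seq m)" for m
    by (simp add: cutoff_Suc add cutoff_bounded_seqs bounded_seqs_scaleR scl unit_seq_bounded_seqs)
  have "f (cutoff 0 x) = 0"
    using scl[OF cutoff_bounded_seqs[of 0 x], of 0] by (simp add: cutoff_0)
  then show ?thesis by (induction m) (simp_all add: step)
qed

text \<open>The functional with coefficients \<open>a 0, \<dots>, a (m - 1)\<close>, extended by \<open>0\<close> as members of the dual are.\<close>

definition finite_functional :: "(nat \<Rightarrow> real) \<Rightarrow> nat \<Rightarrow> (nat \<Rightarrow> real) \<Rightarrow> real"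
  where "finite_functional a m = (\<lambda>x. if x \<in> bounded_seqs then \<Sum>n<m. a n * x n else 0)"

definition coordinate :: "nat \<Rightarrow> (nat \<Rightarrow> real) \<Rightarrow> real"
  where "coordinate n = (\<lambda>x. if x \<in> bounded_seqs then x n else 0)"

lemma coordinate_in_dual: "coordinate n \<in> carr (dual seq_lattice)"
  unfolding coordinate_def
  by (intro dual_memI[of "\<lambda>x. x n" "\<bar>C n\<bar>"] coordinate_le_norm) (auto intro: linearI)

lemma finite_functional_in_dual: "finite_functional a m \<in> carr (dual seq_lattice)"
  unfolding finite_functional_def
proof (rule dual_memI[where K = "\<Sum>n<m. \<bar>a n\<bar> * \<bar>C n\<bar>"])
  show "linear (\<lambda>x. \<Sum>n<m. a n * x n)"
    by (intro linearI) (simp_all add: sum.distrib algebra_simps sum_distrib_left)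
  fix x :: "nat \<Rightarrow> real" assume x: "x \<in> bounded_seqs"
  have "\<bar>\<Sum>n<m. a n * x n\<bar> \<le> (\<Sum>n<m. \<bar>a n\<bar> * (\<bar>C n\<bar> * seq_norm x))"
    using x by (intro order_trans[OF sum_abs] sum_mono)
      (auto simp: abs_mult intro: mult_left_mono coordinate_le_norm)
  then show "\<bar>\<Sum>n<m. a n * x n\<bar> \<le> (\<Sum>n<m. \<bar>a n\<bar> * \<bar>C n\<bar>) * seq_norm x"
    by (simp add: sum_distrib_right mult.assoc)
qed

lemma bidual_finite_functional:
  assumes \<Phi>: "\<Phi> \<in> carr (dual (dual seq_lattice))"
  shows "\<Phi> (finite_functional a m) = (\<Sum>n<m. a n * \<Phi> (coordinate n))"
proof -
  have add: "\<Phi> (f + g) = \<Phi> f + \<Phi> g"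
    if "f \<in> carr (dual seq_lattice)" "g \<in> carr (dual seq_lattice)" for f g
    using \<Phi> that by (simp add: dual_def[of "dual seq_lattice"] bounded_linear_on_def)
  have scl: "\<Phi> (c *\<^sub>R f) = c * \<Phi> f" if "f \<in> carr (dual seq_lattice)" for c f
    using \<Phi> that by (simp add: dual_def[of "dual seq_lattice"] bounded_linear_on_def)
  have "finite_functional a 0 = 0 *\<^sub>R coordinate 0"
    by (simp add: finite_functional_def fun_eq_iff)
  then have zero: "\<Phi> (finite_functional a 0) = 0" using scl[OF coordinate_in_dual, of 0 0] by simp
  have step: "\<Phi> (finite_functional a (Suc m)) = \<Phi> (finite_functional a m) + a m * \<Phi> (coordinate m)" for m
  proof -
    have *: "a m *\<^sub>R coordinate m = finite_functional (\<lambda>n. if n = m then a m else 0) (Suc m)"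
      by (auto simp: finite_functional_def coordinate_def fun_eq_iff)
    have "finite_functional a (Suc m) = finite_functional a m + a m *\<^sub>R coordinate m"
      by (auto simp: finite_functional_def coordinate_def fun_eq_iff)
    moreover have "a m *\<^sub>R coordinate m \<in> carr (dual seq_lattice)"
      unfolding * by (rule finite_functional_in_dual)
    ultimately show ?thesis
      using add[OF finite_functional_in_dual, of "a m *\<^sub>R coordinate m" a m]
        scl[OF coordinate_in_dual] by metis
  qed
  show ?thesis by (induction m) (simp_all add: zero step)
qed

text \<open>
  Let \<open>\<Phi>\<close> be in the bidual and let \<open>x\<close> collect its values at the coordinate functionals. For each
  \<open>m\<close> there is a functional \<open>h \<le> r m\<close> with \<open>h x = r m x\<close>; it depends on finitely many coordinates,
  so \<open>r m x = \<Phi> h \<le> \<parallel>\<Phi>\<parallel>\<close>, and \<open>x\<close> belongs to the space. Evaluation at \<open>x\<close> and \<open>\<Phi>\<close> agree on finitely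
  supported functionals, and the hypothesis says that these are dense in the dual.
\<close>

theorem reflexive_on_seq_lattice:
  assumes tails: "\<And>f \<epsilon>. bounded_linear_on seq_lattice (f :: _ \<Rightarrow> real) \<Longrightarrow> 0 < \<epsilon> \<Longrightarrow>
    \<exists>m. \<forall>x\<in>bounded_seqs. seq_norm x \<le> 1 \<longrightarrow> \<bar>f (x - cutoff m x)\<bar> \<le> \<epsilon>"
  shows "reflexive_on seq_lattice"
  unfolding reflexive_on_def
proof
  fix \<Phi> assume \<Phi>: "\<Phi> \<in> carr (dual (dual seq_lattice))"
  define x where "x n = \<Phi> (coordinate n)" for n
  obtain K0 where K0: "\<And>f. f \<in> carr (dual seq_lattice) \<Longrightarrow> \<bar>\<Phi> f\<bar> \<le> K0 * opnorm seq_lattice f"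
    using \<Phi> by (auto simp: dual_def bounded_linear_on_def)
  define K where "K = \<bar>K0\<bar>"
  have K: "\<bar>\<Phi> f\<bar> \<le> K * \<epsilon>"
    if f: "f \<in> carr (dual seq_lattice)"
      and le: "\<And>x. x \<in> bounded_seqs \<Longrightarrow> seq_norm x \<le> 1 \<Longrightarrow> \<bar>f x\<bar> \<le> \<epsilon>" for f \<epsilon>
  proof -
    have "bounded_linear_on seq_lattice f" using f by (simp add: dual_def)
    from le_opnorm[OF this, of 0] have "0 \<le> opnorm seq_lattice f"
      using seq_norm_le[of 0 0] bounded_seqsI[of 0 0] by auto
    then have "\<bar>\<Phi> f\<bar> \<le> K * opnorm seq_lattice f"
      using K0[OF f] mult_right_mono[OF abs_ge_self[of K0]] by (fastforce simp: K_def)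
    also have "\<dots> \<le> K * \<epsilon>" using le by (intro mult_left_mono opnorm_le) (auto simp: K_def)
    finally show ?thesis .
  qed
  have r_le: "r m x \<le> K" for m
  proof -
    have sub: "sublinear (r m)" by (simp add: sublinear_def triangle scale)
    obtain h where h: "linear h" "\<And>y. h y \<le> r m y" "r m x \<le> h x"
      using Mazur_Orlicz[OF sub, of "{x}" "r m x"] by auto
    have abs: "\<bar>h y\<bar> \<le> r m y" for y
      using h(2)[of y] h(2)[of "- y"] linear_neg[OF h(1), of y] by (simp add: r_uminus abs_le_iff)
    have tr: "h y = h (cutoff m y)" for y
    proof -
      have "r m (y - cutoff m y) \<le> r m 0" by (rule mono) (simp add: cutoff_apply)
      then have "h (y - cutoff m y) = 0" using abs[of "y - cutoff m y"] by simp
      then show ?thesis using linear_diff[OF h(1)] by simp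
    qed
    define a where "a n = h (unit_seq n)" for n
    have ff: "finite_functional a m y = h y" if "y \<in> bounded_seqs" for y
      using that by (simp add: tr[of y] linear_cutoff[OF h(1)] finite_functional_def a_def mult.commute)
    have "r m x \<le> h (cutoff m x)" using h(3) tr by simp
    also have "\<dots> = \<Phi> (finite_functional a m)"
      by (simp add: bidual_finite_functional[OF \<Phi>] linear_cutoff[OF h(1)] a_def x_def mult.commute)
    also have "\<dots> \<le> K * 1"
      using abs r_le_seq_norm ff
      by (intro order_trans[OF abs_ge_self K] finite_functional_in_dual) (fastforce intro: order_trans)+
    finally show ?thesis by simp
  qed
  then have x: "x \<in> bounded_seqs" by (rule bounded_seqsI)
  have "\<Phi> f = f x" if f: "f \<in> carr (dual seq_lattice)" for f
  proof (rule ccontr)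
    assume ne: "\<Phi> f \<noteq> f x"
    have f': "bounded_linear_on seq_lattice f" and off: "\<And>x. x \<notin> bounded_seqs \<Longrightarrow> f x = 0"
      using f by (auto simp: dual_def)
    have f_add: "f (y + z) = f y + f z" if "y \<in> bounded_seqs" "z \<in> bounded_seqs" for y z
      using f' that by (simp add: bounded_linear_on_def)
    have f_scale: "f (c *\<^sub>R y) = c * f y" if "y \<in> bounded_seqs" for c y
      using f' that by (simp add: bounded_linear_on_def)
    have f_diff: "f (y - z) = f y - f z" if "y \<in> bounded_seqs" "z \<in> bounded_seqs" for y z
      using f_add[OF bounded_seqs_diff[OF that] that(2)] by simp
    define a where "a n = f (unit_seq n)" for n
    have f_trunc: "f (cutoff m y) = (\<Sum>n<m. a n * y n)" for m y
      by (simp add: bounded_linear_on_cutoff[OF f'] a_def mult.commute)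
    have ff: "finite_functional a m y = f (cutoff m y)" if "y \<in> bounded_seqs" for m y
      using that by (simp add: finite_functional_def f_trunc)
    \<comment> \<open>
      \<open>\<Phi> f\<close> and \<open>f x\<close> differ from their values at the truncated functional by at most \<open>K * \<epsilon>\<close> and
      \<open>(K + 1) * \<epsilon>\<close>, since both \<open>\<parallel>\<Phi>\<parallel>\<close> and \<open>\<parallel>x\<parallel>\<close> are at most \<open>K\<close>; the choice of \<open>\<epsilon>\<close> makes the sum
      half of the assumed gap. The extra \<open>1\<close> keeps the divisors positive when \<open>K = 0\<close>.\<close>
    define \<epsilon> where "\<epsilon> = \<bar>\<Phi> f - f x\<bar> / (2 * (2 * K + 1))"
    have K0': "0 \<le> K" by (simp add: K_def)
    then have \<epsilon>: "0 < \<epsilon>" using ne by (simp add: \<epsilon>_def)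
    obtain m where m: "\<And>y. y \<in> bounded_seqs \<Longrightarrow> seq_norm y \<le> 1 \<Longrightarrow> \<bar>f (y - cutoff m y)\<bar> \<le> \<epsilon>"
      using tails[OF f' \<epsilon>] by blast
    have cancel: "f y - finite_functional a m y = f (y - cutoff m y)" if "y \<in> bounded_seqs" for y
      using that by (simp add: ff f_diff cutoff_bounded_seqs)
    obtain L where "\<forall>y\<in>bounded_seqs. \<bar>f y\<bar> \<le> L * seq_norm y"
      using f' by (auto simp: bounded_linear_on_def)
    then have L: "\<bar>f y\<bar> \<le> L * seq_norm y" if "y \<in> bounded_seqs" for y using that by blast
    have diff_dual: "f - finite_functional a m \<in> carr (dual seq_lattice)"
    proof -
      have g: "bounded_linear_on seq_lattice (finite_functional a m)"
        using finite_functional_in_dual[of a m] by (simp add: dual_def)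
      then obtain M where "\<forall>y\<in>bounded_seqs. \<bar>finite_functional a m y\<bar> \<le> M * seq_norm y"
        by (auto simp: bounded_linear_on_def)
      then have M: "\<bar>finite_functional a m y\<bar> \<le> M * seq_norm y" if "y \<in> bounded_seqs" for y
        using that by blast
      have "\<bar>f y - finite_functional a m y\<bar> \<le> (L + M) * seq_norm y" if "y \<in> bounded_seqs" for y
        using L[OF that] M[OF that] by (simp add: distrib_right)
      then have "\<exists>K. \<forall>y\<in>bounded_seqs. \<bar>f y - finite_functional a m y\<bar> \<le> K * seq_norm y" by blast
      then show ?thesis
        using g off by (auto simp: dual_def bounded_linear_on_def f_add f_scale algebra_simps
            finite_functional_def)
    qed
    have "\<Phi> (g + h) = \<Phi> g + \<Phi> h"
      if "g \<in> carr (dual seq_lattice)" "h \<in> carr (dual seq_lattice)" for g h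
      using \<Phi> that by (simp add: dual_def[of "dual seq_lattice"] bounded_linear_on_def)
    from this[OF diff_dual finite_functional_in_dual[of a m]] have "\<Phi> f = \<Phi> (f - finite_functional a m) + f (cutoff m x)"
      by (simp add: bidual_finite_functional[OF \<Phi>] f_trunc x_def)
    moreover have "\<bar>\<Phi> (f - finite_functional a m)\<bar> \<le> K * \<epsilon>"
      using m cancel by (intro K diff_dual) auto
    moreover have "\<bar>f (x - cutoff m x)\<bar> \<le> (K + 1) * \<epsilon>"
    proof -
      define c where "c = inverse (K + 1)"
      have c: "0 < c" using K0' by (simp add: c_def)
      have "seq_norm (c *\<^sub>R x) \<le> c * K"
        using r_le c by (intro seq_norm_le) (auto simp: scale intro: mult_left_mono)
      also have "\<dots> \<le> 1" using K0' by (simp add: c_def field_simps)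
      finally have "\<bar>f (c *\<^sub>R x - cutoff m (c *\<^sub>R x))\<bar> \<le> \<epsilon>"
        using x by (intro m bounded_seqs_scaleR)
      moreover have "c *\<^sub>R x - cutoff m (c *\<^sub>R x) = c *\<^sub>R (x - cutoff m x)"
        by (auto simp: fun_eq_iff cutoff_apply)
      ultimately have "\<bar>c * f (x - cutoff m x)\<bar> \<le> \<epsilon>"
        using x by (simp add: f_scale bounded_seqs_diff cutoff_bounded_seqs)
      then show ?thesis using c K0' by (simp add: abs_mult c_def field_simps)
    qed
    moreover have "f (x - cutoff m x) = f x - f (cutoff m x)"
      using x by (intro f_diff cutoff_bounded_seqs)
    ultimately have "\<bar>\<Phi> f - f x\<bar> \<le> (2 * K + 1) * \<epsilon>" by (simp add: algebra_simps)
    also have "\<dots> = \<bar>\<Phi> f - f x\<bar> / 2" using K0' by (simp add: \<epsilon>_def field_simps)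
    finally show False using ne by simp
  qed
  then show "\<exists>x\<in>carr seq_lattice. \<forall>f\<in>carr (dual seq_lattice). \<Phi> f = f x" using x by auto
qed

end

section \<open>Positive functionals on a Banach lattice\<close>

lemma norm_le_of_modulus_le:
  fixes z w :: "'f::banach_lattice"
  assumes "z \<le> w" "- z \<le> w"
  shows "norm z \<le> norm w"
proof (rule norm_mono_modulus)
  have "sup z (- z) \<le> w" using assms by simp
  also have "w \<le> sup w (- w)" by simp
  finally show "sup z (- z) \<le> sup w (- w)" .
qed

lemma norm_mono_pos: "0 \<le> z \<Longrightarrow> z \<le> w \<Longrightarrow> norm z \<le> norm (w :: 'f::banach_lattice)"
  by (rule norm_le_of_modulus_le) (auto intro: order_trans[of "- z" 0])

lemma norm_pos_part_le: "norm (sup y 0) \<le> norm (y :: 'f::banach_lattice)"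
proof (rule norm_mono_modulus)
  have "0 \<le> sup y (- y) + sup y (- y)"
    using add_mono[of y "sup y (- y)" "- y" "sup y (- y)"] by simp
  then have "0 \<le> (1/2::real) *\<^sub>R (sup y (- y) + sup y (- y))"
    by (intro scaleR_nonneg_nonneg) simp_all
  then have 0: "0 \<le> sup y (- y)" by (simp add: scaleR_right_distrib flip: scaleR_left_distrib)
  have s: "sup y 0 \<le> sup y (- y)" using 0 by simp
  have "- sup y 0 \<le> 0" by simp
  then have "- sup y 0 \<le> sup y (- y)" using 0 by (rule order_trans)
  with s show "sup (sup y 0) (- sup y 0) \<le> sup y (- y)" by (rule sup_least)
qed

text \<open>The positive cone is closed, because the negative part of \<open>z\<close> is at most the distance from \<open>z\<close> to the cone.\<close>

lemma nonneg_limit: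
  fixes z :: "'f::banach_lattice"
  assumes lim: "u \<longlonglongrightarrow> z" and nonneg: "\<And>n::nat. 0 \<le> u n"
  shows "0 \<le> z"
proof -
  have "norm (sup (- z) 0) \<le> norm (u n - z)" for n
  proof -
    have "sup (- z) 0 \<le> sup (u n - z) 0"
      using nonneg[of n] by (intro sup_mono) auto
    then have "norm (sup (- z) 0) \<le> norm (sup (u n - z) 0)" by (intro norm_mono_pos) auto
    then show ?thesis using norm_pos_part_le[of "u n - z"] by linarith
  qed
  moreover have "(\<lambda>n. norm (u n - z)) \<longlonglongrightarrow> 0" using lim by (simp add: LIM_zero tendsto_norm_zero)
  ultimately have "norm (sup (- z) 0) \<le> 0" by (intro LIMSEQ_le_const) auto
  then have "sup (- z) 0 = 0" by simp
  then have "- z \<le> 0" by (metis sup_ge1)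
  then show ?thesis by simp
qed

lemma sublinear_norm_pos_part: "sublinear (\<lambda>x :: 'f::banach_lattice. norm (sup x 0))"
proof (rule sublinearI)
  fix x y :: 'f and c :: real
  have "norm (sup (x + y) 0) \<le> norm (sup x 0 + sup y 0)"
    by (intro norm_mono_pos) (auto intro: add_mono add_nonneg_nonneg)
  then show "norm (sup (x + y) 0) \<le> norm (sup x 0) + norm (sup y 0)"
    using norm_triangle_ineq order_trans by blast
  assume c: "0 < c"
  have "norm (sup (c *\<^sub>R x) 0) \<le> norm (c *\<^sub>R sup x 0)"
    using c by (intro norm_mono_pos) (auto intro: scaleR_left_mono scaleR_nonneg_nonneg)
  then show "norm (sup (c *\<^sub>R x) 0) \<le> c * norm (sup x 0)" using c by simp
qed simp

text \<open>
  The positive part of the dual unit ball: domination by the norm of the positive part expresses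
  positivity and norm at most one in a single sublinear bound.
\<close>

definition positive_functionals :: "('f::banach_lattice \<Rightarrow> real) set"
  where "positive_functionals = {\<phi>. linear \<phi> \<and> (\<forall>x. \<phi> x \<le> norm (sup x 0))}"

lemma positive_functionals_linear: "\<phi> \<in> positive_functionals \<Longrightarrow> linear \<phi>"
  by (simp add: positive_functionals_def)

lemma positive_functionals_nonneg:
  assumes "\<phi> \<in> positive_functionals" "0 \<le> z"
  shows "0 \<le> \<phi> z"
proof -
  have "sup (- z) 0 = 0" using assms(2) by (simp add: sup_absorb2)
  moreover have "\<phi> (- z) \<le> norm (sup (- z) 0)"
    using assms(1) by (simp add: positive_functionals_def)
  ultimately have "\<phi> (- z) \<le> 0" by simp
  then show ?thesis using linear_neg[OF positive_functionals_linear[OF assms(1)], of z] by simp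
qed

lemma positive_functionals_le_norm:
  assumes "\<phi> \<in> positive_functionals"
  shows "\<bar>\<phi> x\<bar> \<le> norm x"
proof -
  have le: "\<phi> y \<le> norm y" for y
    using assms norm_pos_part_le[of y] unfolding positive_functionals_def
    by (blast intro: order_trans)
  show ?thesis
    using le[of x] le[of "- x"] linear_neg[OF positive_functionals_linear[OF assms], of x] by simp
qed

lemma zero_positive_functional: "(\<lambda>_. 0) \<in> positive_functionals"
  by (simp add: positive_functionals_def linear_zero)

lemma ex_norming_positive_functional:
  fixes z :: "'f::banach_lattice"
  assumes "0 \<le> z"
  shows "\<exists>\<phi>\<in>positive_functionals. norm z \<le> \<phi> z"
proof -
  have "norm z \<le> norm (sup z 0)" using assms by (simp add: sup_absorb1)
  then show ?thesis
    using Mazur_Orlicz[OF sublinear_norm_pos_part, of "{z}" "norm z"]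
    by (auto simp: positive_functionals_def)
qed

lemma positive_functionals_weakly_null:
  fixes f :: "nat \<Rightarrow> 'f::banach_lattice"
  assumes "weakly_null f" and \<phi>: "\<phi> \<in> positive_functionals"
  shows "(\<lambda>n. \<phi> (f n)) \<longlonglongrightarrow> 0"
proof -
  have "bounded_linear \<phi>"
    using positive_functionals_linear[OF \<phi>] positive_functionals_le_norm[OF \<phi>]
    by (intro bounded_linear.intro bounded_linear_axioms.intro) (auto intro!: exI[of _ 1])
  then have "blinfun_apply (Blinfun \<phi>) = \<phi>" by (rule bounded_linear_Blinfun_apply)
  then show ?thesis using assms(1) unfolding weakly_null_def by metis
qed

section \<open>The mixed norm of a weakly null sequence\<close>

text \<open>
  The zero vector at index \<open>0\<close> reserves a coordinate that the operator will not see.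
\<close>

locale weakly_null_sequence =
  fixes f :: "nat \<Rightarrow> 'f::banach_lattice"
  assumes f_0: "f 0 = 0" and f_nonneg: "0 \<le> f n" and norm_f: "1 \<le> n \<Longrightarrow> norm (f n) = 1"
    and weak: "\<phi> \<in> positive_functionals \<Longrightarrow> (\<lambda>n. \<phi> (f n)) \<longlonglongrightarrow> 0"
begin

lemma functional_f:
  "\<phi> \<in> positive_functionals \<Longrightarrow> 0 \<le> \<phi> (f n)"
  "\<phi> \<in> positive_functionals \<Longrightarrow> \<phi> (f n) \<le> 1"
proof -
  assume \<phi>: "\<phi> \<in> positive_functionals"
  show "0 \<le> \<phi> (f n)" by (rule positive_functionals_nonneg[OF \<phi> f_nonneg])
  have "norm (f n) \<le> 1" using norm_f[of n] f_0 by (cases n) auto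
  then show "\<phi> (f n) \<le> 1" using positive_functionals_le_norm[OF \<phi>, of "f n"] by linarith
qed

definition comb :: "nat \<Rightarrow> (nat \<Rightarrow> real) \<Rightarrow> 'f"
  where "comb m x = (\<Sum>n<m. \<bar>x n\<bar> *\<^sub>R f n)"

text \<open>
  \<open>\<phi> (f n)\<close> is magnified by \<open>4 ^ k\<close> and truncated at \<open>1\<close>. The resulting lattice seminorms
  \<open>level k m x\<close> increase with \<open>k\<close> from the norm of \<open>\<Sum>n<m. \<bar>x n\<bar> *\<^sub>R f n\<close> towards the \<open>\<ell>\<^sub>1\<close>-norm on the
  indices \<open>n \<ge> 1\<close>. They play the role of the interpolation norms in the factorization
  of weakly compact operators through reflexive spaces.
\<close>

definition weight :: "nat \<Rightarrow> ('f \<Rightarrow> real) \<Rightarrow> nat \<Rightarrow> real"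
  where "weight k \<phi> n = min 1 (4 ^ k * \<phi> (f n))"

definition level_sum :: "nat \<Rightarrow> nat \<Rightarrow> (nat \<Rightarrow> real) \<Rightarrow> ('f \<Rightarrow> real) \<Rightarrow> real"
  where "level_sum k m x \<phi> = (\<Sum>n<m. weight k \<phi> n * \<bar>x n\<bar>)"

definition level :: "nat \<Rightarrow> nat \<Rightarrow> (nat \<Rightarrow> real) \<Rightarrow> real"
  where "level k m x = (SUP \<phi>\<in>positive_functionals. level_sum k m x \<phi>)"

text \<open>
  The damping \<open>2 ^ Suc k\<close> is large enough for unit sequences to have mixed norm at most one, but small
  against the magnification \<open>4 ^ k\<close>; the gap between the two rates drives every estimate below.
\<close>

definition scaled_level :: "nat \<Rightarrow> (nat \<Rightarrow> real) \<Rightarrow> nat \<Rightarrow> real"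
  where "scaled_level m x k = level k m x / 2 ^ Suc k"

definition mixed :: "nat \<Rightarrow> (nat \<Rightarrow> real) \<Rightarrow> real"
  where "mixed m x = sqrt (\<Sum>k. (scaled_level m x k)\<^sup>2)"

lemma weight_bounds:
  assumes "\<phi> \<in> positive_functionals"
  shows "0 \<le> weight k \<phi> n" "weight k \<phi> n \<le> 1"
  using functional_f[OF assms, of n] by (auto simp: weight_def)

lemma comb_nonneg: "0 \<le> comb m x"
  unfolding comb_def by (intro sum_nonneg scaleR_nonneg_nonneg f_nonneg) simp

lemma functional_comb: "\<phi> \<in> positive_functionals \<Longrightarrow> \<phi> (comb m x) = (\<Sum>n<m. \<phi> (f n) * \<bar>x n\<bar>)"
  unfolding comb_def
  by (simp add: linear_sum[OF positive_functionals_linear] linear_scale[OF positive_functionals_linear]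
      mult.commute)

lemma level_sum_le_sum: "\<phi> \<in> positive_functionals \<Longrightarrow> level_sum k m x \<phi> \<le> (\<Sum>n<m. \<bar>x n\<bar>)"
  unfolding level_sum_def using weight_bounds
  by (intro sum_mono) (simp add: mult_left_le_one_le)

lemma level_upper: "\<phi> \<in> positive_functionals \<Longrightarrow> level_sum k m x \<phi> \<le> level k m x"
  unfolding level_def using level_sum_le_sum by (intro cSUP_upper) (auto intro!: bdd_aboveI)

lemma level_least:
  "(\<And>\<phi>. \<phi> \<in> positive_functionals \<Longrightarrow> level_sum k m x \<phi> \<le> B) \<Longrightarrow> level k m x \<le> B"
  unfolding level_def using zero_positive_functional by (intro cSUP_least) auto

lemma level_nonneg: "0 \<le> level k m x"
proof -
  have "0 \<le> level_sum k m x (\<lambda>_. 0)" by (simp add: level_sum_def weight_def)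
  then show ?thesis using level_upper[OF zero_positive_functional] order_trans by blast
qed

lemma level_le_sum: "level k m x \<le> (\<Sum>n<m. \<bar>x n\<bar>)"
  by (intro level_least level_sum_le_sum)

lemma level_sum_mono:
  "\<phi> \<in> positive_functionals \<Longrightarrow> (\<And>n. n < m \<Longrightarrow> \<bar>x n\<bar> \<le> \<bar>y n\<bar>) \<Longrightarrow>
    level_sum k m x \<phi> \<le> level_sum k m y \<phi>"
  unfolding level_sum_def using weight_bounds by (intro sum_mono mult_left_mono) auto

lemma level_mono: "(\<And>n. n < m \<Longrightarrow> \<bar>x n\<bar> \<le> \<bar>y n\<bar>) \<Longrightarrow> level k m x \<le> level k m y"
  by (intro level_least order_trans[OF level_sum_mono level_upper])

lemma level_triangle: "level k m (x + y) \<le> level k m x + level k m y"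
proof (rule level_least)
  fix \<phi> :: "'f \<Rightarrow> real" assume \<phi>: "\<phi> \<in> positive_functionals"
  have "level_sum k m (x + y) \<phi> \<le> (\<Sum>n<m. weight k \<phi> n * \<bar>x n\<bar> + weight k \<phi> n * \<bar>y n\<bar>)"
    unfolding level_sum_def using weight_bounds[OF \<phi>]
    by (intro sum_mono) (simp add: mult_left_mono flip: distrib_left)
  also have "\<dots> = level_sum k m x \<phi> + level_sum k m y \<phi>" by (simp add: level_sum_def sum.distrib)
  finally show "level_sum k m (x + y) \<phi> \<le> level k m x + level k m y"
    using level_upper[OF \<phi>, of k m x] level_upper[OF \<phi>, of k m y] by linarith
qed

lemma level_scale: "level k m (c *\<^sub>R x) = \<bar>c\<bar> * level k m x"
proof -
  have sum: "level_sum k m (c *\<^sub>R x) \<phi> = \<bar>c\<bar> * level_sum k m x \<phi>" for \<phi> c x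
    by (simp add: level_sum_def sum_distrib_left abs_mult mult.left_commute)
  have le: "level k m (c *\<^sub>R x) \<le> \<bar>c\<bar> * level k m x" for c x
    by (rule level_least) (auto simp: sum intro: mult_left_mono level_upper)
  show ?thesis
  proof (cases "c = 0")
    case True
    then show ?thesis using le[of c x] level_nonneg[of k m "c *\<^sub>R x"] by simp
  next
    case False
    have "level k m (inverse c *\<^sub>R (c *\<^sub>R x)) \<le> \<bar>inverse c\<bar> * level k m (c *\<^sub>R x)" by (rule le)
    then have "\<bar>c\<bar> * level k m x \<le> level k m (c *\<^sub>R x)"
      using False by (simp add: abs_inverse field_simps)
    then show ?thesis using le[of c x] by simp
  qed
qed

lemma level_cutoff: "j \<le> m \<Longrightarrow> level k m (cutoff j x) = level k j x"
proof -
  assume "j \<le> m"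
  then have "level_sum k m (cutoff j x) \<phi> = level_sum k j x \<phi>" for \<phi>
    unfolding level_sum_def
    by (intro sum.mono_neutral_cong_right) (auto simp: cutoff_apply)
  then show ?thesis by (simp add: level_def)
qed

lemma level_le_norm_comb: "level k m x \<le> 4 ^ k * norm (comb m x)"
proof (rule level_least)
  fix \<phi> :: "'f \<Rightarrow> real" assume \<phi>: "\<phi> \<in> positive_functionals"
  have "level_sum k m x \<phi> \<le> (\<Sum>n<m. 4 ^ k * \<phi> (f n) * \<bar>x n\<bar>)"
    unfolding level_sum_def by (intro sum_mono mult_right_mono) (auto simp: weight_def)
  also have "\<dots> = 4 ^ k * \<phi> (comb m x)"
    by (simp add: functional_comb[OF \<phi>] sum_distrib_left mult.assoc)
  also have "\<dots> \<le> 4 ^ k * norm (comb m x)"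
    using positive_functionals_le_norm[OF \<phi>, of "comb m x"] by (intro mult_left_mono) auto
  finally show "level_sum k m x \<phi> \<le> 4 ^ k * norm (comb m x)" .
qed

text \<open>
  At level \<open>0\<close> nothing is truncated, because \<open>\<phi> (f n) \<le> 1\<close>, so a positive functional norming the
  combination turns its norm into a level sum.
\<close>

lemma norm_comb_le_level: "norm (comb m x) \<le> level 0 m x"
proof -
  obtain \<phi> where \<phi>: "\<phi> \<in> positive_functionals" "norm (comb m x) \<le> \<phi> (comb m x)"
    using ex_norming_positive_functional[OF comb_nonneg] by blast
  have "weight 0 \<phi> n = \<phi> (f n)" for n using functional_f[OF \<phi>(1)] by (simp add: weight_def)
  then have "\<phi> (comb m x) = level_sum 0 m x \<phi>"
    by (simp add: functional_comb[OF \<phi>(1)] level_sum_def)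
  then show ?thesis using \<phi>(2) level_upper[OF \<phi>(1), of 0 m x] by linarith
qed

lemma coordinate_le_level:
  assumes "1 \<le> n" "n < m"
  shows "\<bar>x n\<bar> \<le> level 0 m x"
proof -
  have "\<bar>x n\<bar> = norm (\<bar>x n\<bar> *\<^sub>R f n)" using norm_f[OF assms(1)] by simp
  also have "\<dots> \<le> norm (comb m x)"
    unfolding comb_def using assms(2)
      sum_mono2[of "{..<m}" "{n}" "\<lambda>n. \<bar>x n\<bar> *\<^sub>R f n"]
    by (intro norm_mono_pos scaleR_nonneg_nonneg f_nonneg) (auto simp: scaleR_nonneg_nonneg f_nonneg)
  also have "\<dots> \<le> level 0 m x" by (rule norm_comb_le_level)
  finally show ?thesis .
qed

lemma scaled_level_nonneg: "0 \<le> scaled_level m x k"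
  by (simp add: scaled_level_def level_nonneg)

lemma scaled_level_le_sum: "scaled_level m x k \<le> (\<Sum>n<m. \<bar>x n\<bar>) / 2 ^ Suc k"
  unfolding scaled_level_def using level_le_sum by (intro divide_right_mono) auto

lemma summable_scaled_level: "summable (\<lambda>k. (scaled_level m x k)\<^sup>2)"
proof (rule summable_comparison_test')
  show "summable (\<lambda>k. (\<Sum>n<m. \<bar>x n\<bar>)\<^sup>2 * (1 / 4) ^ Suc k)"
    by (intro summable_mult summable_Suc_iff[THEN iffD2] summable_geometric) simp
  fix k
  have "(scaled_level m x k)\<^sup>2 \<le> ((\<Sum>n<m. \<bar>x n\<bar>) / 2 ^ Suc k)\<^sup>2"
    using scaled_level_le_sum scaled_level_nonneg by (intro power_mono)
  also have "\<dots> = (\<Sum>n<m. \<bar>x n\<bar>)\<^sup>2 * (1 / 4) ^ Suc k"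
    by (simp add: power_divide power2_eq_square flip: power_mult_distrib)
  finally show "norm ((scaled_level m x k)\<^sup>2) \<le> (\<Sum>n<m. \<bar>x n\<bar>)\<^sup>2 * (1 / 4) ^ Suc k"
    by simp
qed

lemma mixed_nonneg: "0 \<le> mixed m x"
  unfolding mixed_def by (intro real_sqrt_ge_zero suminf_nonneg summable_scaled_level) simp

lemma mixed_sq: "(mixed m x)\<^sup>2 = (\<Sum>k. (scaled_level m x k)\<^sup>2)"
  unfolding mixed_def by (intro real_sqrt_pow2 suminf_nonneg summable_scaled_level) simp

lemma sum_scaled_level_le: "finite K \<Longrightarrow> (\<Sum>k\<in>K. (scaled_level m x k)\<^sup>2) \<le> (mixed m x)\<^sup>2"
  unfolding mixed_sq by (intro sum_le_suminf summable_scaled_level) auto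

lemma mixed_leI:
  assumes "\<And>K. (\<Sum>k<K. (scaled_level m x k)\<^sup>2) \<le> B\<^sup>2" "0 \<le> B"
  shows "mixed m x \<le> B"
  unfolding mixed_def
  by (intro real_le_lsqrt suminf_le_const summable_scaled_level assms suminf_nonneg)

lemma scaled_level_le_mixed: "scaled_level m x k \<le> mixed m x"
  using sum_scaled_level_le[of "{k}" m x] by (intro power2_le_imp_le[OF _ mixed_nonneg]) simp

lemma level_le_mixed: "level k m x \<le> 2 ^ Suc k * mixed m x"
  using scaled_level_le_mixed[of m x k] by (simp add: scaled_level_def field_simps)

lemma scaled_level_triangle: "scaled_level m (x + y) k \<le> scaled_level m x k + scaled_level m y k"
  unfolding scaled_level_def add_divide_distrib[symmetric]
  by (intro divide_right_mono level_triangle) simp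

lemma scaled_level_scale: "scaled_level m (c *\<^sub>R x) k = \<bar>c\<bar> * scaled_level m x k"
  by (simp add: scaled_level_def level_scale)

lemma mixed_triangle: "mixed m (x + y) \<le> mixed m x + mixed m y"
proof (rule mixed_leI)
  fix K
  have L2: "L2_set (scaled_level m z) {..<K} \<le> mixed m z" for z
    unfolding L2_set_def by (rule real_le_lsqrt[OF mixed_nonneg sum_scaled_level_le]) simp
  have "L2_set (scaled_level m (x + y)) {..<K}
      \<le> L2_set (\<lambda>k. scaled_level m x k + scaled_level m y k) {..<K}"
    by (intro L2_set_mono scaled_level_triangle scaled_level_nonneg)
  also have "\<dots> \<le> L2_set (scaled_level m x) {..<K} + L2_set (scaled_level m y) {..<K}"
    by (rule L2_set_triangle_ineq)
  also have "\<dots> \<le> mixed m x + mixed m y" by (intro add_mono L2)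
  finally have "(L2_set (scaled_level m (x + y)) {..<K})\<^sup>2 \<le> (mixed m x + mixed m y)\<^sup>2"
    by (intro power_mono L2_set_nonneg)
  then show "(\<Sum>k<K. (scaled_level m (x + y) k)\<^sup>2) \<le> (mixed m x + mixed m y)\<^sup>2"
    unfolding L2_set_def by (simp add: sum_nonneg)
qed (simp add: mixed_nonneg)

lemma mixed_scale: "mixed m (c *\<^sub>R x) = \<bar>c\<bar> * mixed m x"
proof -
  have "(\<Sum>k. (scaled_level m (c *\<^sub>R x) k)\<^sup>2) = (\<Sum>k. c\<^sup>2 * (scaled_level m x k)\<^sup>2)"
    by (simp add: scaled_level_scale power_mult_distrib)
  also have "\<dots> = c\<^sup>2 * (\<Sum>k. (scaled_level m x k)\<^sup>2)"
    by (rule suminf_mult[OF summable_scaled_level])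
  finally show ?thesis by (simp add: mixed_def real_sqrt_mult)
qed

lemma mixed_mono: "(\<And>n. n < m \<Longrightarrow> \<bar>x n\<bar> \<le> \<bar>y n\<bar>) \<Longrightarrow> mixed m x \<le> mixed m y"
  unfolding mixed_def scaled_level_def
  by (intro real_sqrt_le_mono suminf_le power_mono divide_right_mono level_mono
      summable_scaled_level[unfolded scaled_level_def]) (auto simp: level_nonneg)

lemma mixed_cutoff: "j \<le> m \<Longrightarrow> mixed m (cutoff j x) = mixed j x"
  by (simp add: mixed_def scaled_level_def level_cutoff)

lemma mixed_unit_le: "mixed m (unit_seq n) \<le> 1"
proof (rule mixed_leI)
  fix K
  have "(\<Sum>i<m. \<bar>unit_seq n i\<bar>) \<le> (1::real)" by (simp add: unit_seq_def if_distrib cong: if_cong)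
  then have "scaled_level m (unit_seq n) k \<le> 1 / 2 ^ Suc k" for k
    by (intro order_trans[OF scaled_level_le_sum] divide_right_mono) auto
  then have "(\<Sum>k<K. (scaled_level m (unit_seq n) k)\<^sup>2) \<le> (\<Sum>k<K. (1 / 2 ^ Suc k)\<^sup>2)"
    by (intro sum_mono power_mono scaled_level_nonneg)
  also have "\<dots> = (1 - (1 / 4) ^ K) / 3"
  proof (induction K)
    case (Suc K)
    have "((1::real) / 2 ^ Suc K)\<^sup>2 = (1 / 4) ^ K / 4"
      by (simp add: power_one_over power2_eq_square flip: power_mult_distrib)
    with Suc show ?case by simp
  qed simp
  also have "\<dots> \<le> 1\<^sup>2"
  proof -
    have "(1 - u) / 3 \<le> 1" if "0 \<le> u" for u :: real
      using that by (simp add: divide_le_eq)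
    then show ?thesis by (metis one_power2 zero_le_divide_1_iff zero_le_numeral zero_le_power)
  qed
  finally show "(\<Sum>k<K. (scaled_level m (unit_seq n) k)\<^sup>2) \<le> 1\<^sup>2" .
qed simp

end

section \<open>Tails of vectors and tails of functionals\<close>

lemma four_power: "(4::real) ^ k = 2 ^ k * 2 ^ k"
  by (simp flip: power_mult_distrib)

context weakly_null_sequence
begin

lemma level_mono_index: "j \<le> m \<Longrightarrow> level k j x \<le> level k m x"
  using level_mono[of m "cutoff j x" x k] level_cutoff[of j m k x] by (simp add: cutoff_apply)

lemma scaled_level_mono:
  "(\<And>n. n < m \<Longrightarrow> \<bar>x n\<bar> \<le> \<bar>y n\<bar>) \<Longrightarrow> scaled_level m x k \<le> scaled_level m y k"
  unfolding scaled_level_def by (intro divide_right_mono level_mono) auto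

text \<open>
  If the tails stayed above \<open>\<epsilon>\<close>, there would be functionals \<open>\<phi>\<close> on successive blocks, each with
  a level sum above \<open>\<epsilon>\<close>. The average of \<open>4 ^ r\<close> of them is again admissible, and
  magnifying it by a further \<open>4 ^ r\<close> undoes the averaging, so level \<open>s + r\<close> would be at least
  \<open>4 ^ r * \<epsilon>\<close>. A bounded mixed norm allows growth of order \<open>2 ^ r\<close> only.
\<close>

lemma level_tail:
  assumes bounded: "\<And>m. mixed m x \<le> M" and \<epsilon>: "0 < \<epsilon>"
  shows "\<forall>\<^sub>F m in sequentially. \<forall>j. level s j (x - cutoff m x) \<le> \<epsilon>"
proof (rule ccontr)
  assume "\<not> ?thesis"
  then have *: "\<exists>m\<ge>m0. \<exists>j. \<epsilon> < level s j (x - cutoff m x)" for m0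
    by (auto simp: eventually_sequentially not_le)
  have block: "\<exists>\<phi>\<in>positive_functionals. \<exists>j. \<epsilon> < (\<Sum>n\<in>{m0..<j}. weight s \<phi> n * \<bar>x n\<bar>)" for m0
  proof -
    obtain m j where m: "m0 \<le> m" and j: "\<epsilon> < level s j (x - cutoff m x)" using * by blast
    obtain \<phi> where \<phi>: "\<phi> \<in> positive_functionals" "\<epsilon> < level_sum s j (x - cutoff m x) \<phi>"
      using level_least[of s j "x - cutoff m x" \<epsilon>] j by force
    have "level_sum s j (x - cutoff m x) \<phi> \<le> (\<Sum>n<j. if m0 \<le> n then weight s \<phi> n * \<bar>x n\<bar> else 0)"
      unfolding level_sum_def using weight_bounds[OF \<phi>(1)] m
      by (intro sum_mono) (auto simp: cutoff_apply)
    also have "\<dots> = (\<Sum>n\<in>{m0..<j}. weight s \<phi> n * \<bar>x n\<bar>)"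
      by (intro sum.mono_neutral_cong_right) auto
    finally show ?thesis using \<phi> order_less_le_trans by blast
  qed
  have stack: "\<exists>h j. linear h \<and> (\<forall>y. h y \<le> real J * norm (sup y 0)) \<and> (\<forall>n. 0 \<le> h (f n)) \<and>
      real J * \<epsilon> \<le> level_sum s j x h" for J
  proof (induction J)
    case 0
    show ?case by (intro exI[of _ "\<lambda>_. 0"] exI[of _ 0]) (simp add: linear_zero level_sum_def)
  next
    case (Suc J)
    then obtain h j where h: "linear h" "\<And>y. h y \<le> real J * norm (sup y 0)" "\<And>n. 0 \<le> h (f n)"
      and hj: "real J * \<epsilon> \<le> level_sum s j x h" by blast
    obtain \<phi> i where \<phi>: "\<phi> \<in> positive_functionals"
      and i: "\<epsilon> < (\<Sum>n\<in>{j..<i}. weight s \<phi> n * \<bar>x n\<bar>)"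
      using block by blast
    have ji: "j \<le> i" using i \<epsilon> by (cases "j \<le> i") auto
    let ?h = "\<lambda>y. h y + \<phi> y"
    have w: "weight s h n \<le> weight s ?h n" "weight s \<phi> n \<le> weight s ?h n" for n
      unfolding weight_def using h(3)[of n] functional_f(1)[OF \<phi>, of n]
      by (intro min.mono mult_left_mono; simp)+
    have "real (Suc J) * \<epsilon> \<le> level_sum s j x h + (\<Sum>n\<in>{j..<i}. weight s \<phi> n * \<bar>x n\<bar>)"
      using hj i by (simp add: distrib_right)
    also have "\<dots> \<le> (\<Sum>n<j. weight s ?h n * \<bar>x n\<bar>) + (\<Sum>n\<in>{j..<i}. weight s ?h n * \<bar>x n\<bar>)"
      unfolding level_sum_def by (intro add_mono sum_mono mult_right_mono w) auto
    also have "\<dots> = level_sum s i x ?h"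
      unfolding level_sum_def using ji
      by (subst sum.union_disjoint[symmetric]) (auto simp: ivl_disj_un)
    finally have "real (Suc J) * \<epsilon> \<le> level_sum s i x ?h" .
    moreover have "linear ?h" using h(1) positive_functionals_linear[OF \<phi>] by (rule linear_compose_add)
    moreover have "?h y \<le> real (Suc J) * norm (sup y 0)" for y
    proof -
      have "\<phi> y \<le> norm (sup y 0)" using \<phi> by (simp add: positive_functionals_def)
      with h(2)[of y] show ?thesis by (simp add: distrib_right)
    qed
    moreover have "0 \<le> ?h (f n)" for n using h(3) functional_f(1)[OF \<phi>] by simp
    ultimately show ?case by blast
  qed
  obtain r where r: "2 ^ Suc s * M / \<epsilon> < 2 ^ r" using real_arch_pow[of 2] by force
  obtain h j where h: "linear h" "\<And>y. h y \<le> 4 ^ r * norm (sup y 0)"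
    and hj: "4 ^ r * \<epsilon> \<le> level_sum s j x h" using stack[of "4 ^ r"] by auto
  define \<phi> where "\<phi> y = h y / 4 ^ r" for y
  have "linear \<phi>" unfolding \<phi>_def
    using linear_compose_scale_right[OF h(1), of "1 / 4 ^ r"] by (simp add: field_simps)
  then have \<phi>: "\<phi> \<in> positive_functionals"
    using h(2) by (simp add: positive_functionals_def \<phi>_def field_simps)
  have "weight (s + r) \<phi> n = weight s h n" for n by (simp add: weight_def \<phi>_def power_add)
  then have "level_sum s j x h = level_sum (s + r) j x \<phi>" by (simp add: level_sum_def)
  also have "\<dots> \<le> level (s + r) j x" by (rule level_upper[OF \<phi>])
  also have "\<dots> \<le> 2 ^ Suc (s + r) * M"
    by (intro order_trans[OF level_le_mixed] mult_left_mono bounded) simp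
  finally have "4 ^ r * \<epsilon> \<le> 2 ^ Suc (s + r) * M" using hj by (rule order_trans[rotated])
  then have "2 ^ r * \<epsilon> \<le> 2 ^ Suc s * M" by (simp add: power_add four_power mult_ac)
  with r \<epsilon> show False by (simp add: field_simps)
qed

text \<open>
  The squares of the suprema \<open>P k\<close> over all initial segments are summable, and they dominate the
  tails of \<open>x\<close> at every level; so \<open>level_tail\<close> is needed only for finitely many \<open>k\<close>.
\<close>

lemma mixed_tail:
  assumes bounded: "\<And>m. mixed m x \<le> M" and \<epsilon>: "0 < \<epsilon>"
  shows "\<forall>\<^sub>F m in sequentially. \<forall>j. mixed j (x - cutoff m x) \<le> \<epsilon>"
proof -
  define P where "P k = (SUP j. scaled_level j x k)" for k
  have bdd: "bdd_above (range (\<lambda>j. scaled_level j x k))" for k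
    using order_trans[OF scaled_level_le_mixed bounded] by (auto intro!: bdd_aboveI)
  have le_P: "scaled_level j x k \<le> P k" for j k
    unfolding P_def using bdd by (intro cSUP_upper) auto
  have lim: "(\<lambda>j. scaled_level j x k) \<longlonglongrightarrow> P k" for k
    unfolding P_def
    by (intro LIMSEQ_incseq_SUP bdd incseq_SucI)
      (simp add: scaled_level_def divide_right_mono level_mono_index)
  have "(\<Sum>k<K. (P k)\<^sup>2) \<le> M\<^sup>2" for K
  proof (rule LIMSEQ_le_const2)
    show "(\<lambda>j. \<Sum>k<K. (scaled_level j x k)\<^sup>2) \<longlonglongrightarrow> (\<Sum>k<K. (P k)\<^sup>2)"
      by (intro tendsto_intros lim)
    show "\<exists>N. \<forall>j\<ge>N. (\<Sum>k<K. (scaled_level j x k)\<^sup>2) \<le> M\<^sup>2"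
      using order_trans[OF sum_scaled_level_le power_mono[OF bounded mixed_nonneg]] by blast
  qed
  then have sumP: "summable (\<lambda>k. (P k)\<^sup>2)" by (intro summableI_nonneg_bounded[where x = "M\<^sup>2"]) auto
  have "0 < \<epsilon>\<^sup>2 / 2" using \<epsilon> by simp
  then obtain K where K: "norm (\<Sum>k. (P (k + K))\<^sup>2) < \<epsilon>\<^sup>2 / 2"
    using suminf_exist_split[OF _ sumP] by blast
  define \<delta> where "\<delta> = \<epsilon> / (2 * (real K + 1))"
  have \<delta>: "0 < \<delta>" using \<epsilon> by (simp add: \<delta>_def)
  have K\<delta>: "real K * \<delta>\<^sup>2 \<le> \<epsilon>\<^sup>2 / 2"
  proof -
    have "real K * \<delta>\<^sup>2 \<le> (real K + 1) * \<delta>\<^sup>2 * (real K + 1)"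
      using mult_mono[of "real K" "(real K + 1) * (real K + 1)" "\<delta>\<^sup>2" "\<delta>\<^sup>2"]
      by (simp add: algebra_simps)
    also have "\<dots> = ((real K + 1) * \<delta>)\<^sup>2" by (simp add: power2_eq_square)
    also have "(real K + 1) * \<delta> = \<epsilon> / 2" by (simp add: \<delta>_def field_simps)
    also have "(\<epsilon> / 2)\<^sup>2 \<le> \<epsilon>\<^sup>2 / 2" by (simp add: power_divide)
    finally show ?thesis .
  qed
  have "\<forall>\<^sub>F m in sequentially. \<forall>k\<in>{..<K}. \<forall>j. level k j (x - cutoff m x) \<le> \<delta>"
    by (intro eventually_ball_finite ballI level_tail[OF bounded \<delta>]) simp
  then show ?thesis
  proof eventually_elim
    case (elim m)
    let ?t = "x - cutoff m x"
    have "mixed j ?t \<le> \<epsilon>" for j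
    proof -
      have small: "scaled_level j ?t k \<le> \<delta>" if "k < K" for k
      proof -
        have "level k j ?t / 2 ^ Suc k \<le> level k j ?t / 1"
          by (intro divide_left_mono level_nonneg one_le_power) simp_all
        moreover have "level k j ?t \<le> \<delta>" using elim that by blast
        ultimately show ?thesis by (simp add: scaled_level_def)
      qed
      have le: "scaled_level j ?t k \<le> P k" for k
        using scaled_level_mono[of j ?t x k] le_P[of j k] by (force simp: cutoff_apply)
      have "(mixed j ?t)\<^sup>2 = (\<Sum>k. (scaled_level j ?t (k + K))\<^sup>2) + (\<Sum>k<K. (scaled_level j ?t k)\<^sup>2)"
        unfolding mixed_sq by (rule suminf_split_initial_segment[OF summable_scaled_level])
      also have "\<dots> \<le> (\<Sum>k. (P (k + K))\<^sup>2) + (\<Sum>k<K. \<delta>\<^sup>2)"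
        using small
        by (intro add_mono suminf_le sum_mono power_mono le scaled_level_nonneg
            summable_ignore_initial_segment sumP summable_scaled_level) auto
      also have "\<dots> \<le> \<epsilon>\<^sup>2 / 2 + \<epsilon>\<^sup>2 / 2" using K K\<delta> by (intro add_mono) auto
      finally have "(mixed j ?t)\<^sup>2 \<le> \<epsilon>\<^sup>2" by simp
      then show ?thesis using less_imp_le[OF \<epsilon>] by (rule power2_le_imp_le)
    qed
    then show ?case by blast
  qed
qed

lemma comb_cutoff: "j \<le> m \<Longrightarrow> comb m (cutoff j x) = comb j x"
  unfolding comb_def by (intro sum.mono_neutral_cong_right) (auto simp: cutoff_apply)

lemma comb_nonneg_combination:
  assumes "\<And>n. 0 \<le> x n" "\<And>n. 0 \<le> y n" "0 \<le> u" "0 \<le> v"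
  shows "comb m (u *\<^sub>R x + v *\<^sub>R y) = u *\<^sub>R comb m x + v *\<^sub>R comb m y"
  using assms
  by (simp add: comb_def scaleR_sum_right scaleR_add_left abs_of_nonneg flip: sum.distrib)

lemma sum_cutoff:
  fixes a :: "nat \<Rightarrow> real"
  shows "j \<le> m \<Longrightarrow> (\<Sum>n<m. a n * cutoff j x n) = (\<Sum>n<j. a n * x n)"
  by (intro sum.mono_neutral_cong_right) (auto simp: cutoff_apply)

text \<open>
  For a fixed \<open>x\<close> the scaled levels decay geometrically, so only finitely many levels of \<open>y\<close>
  matter, and on these a small \<open>norm (comb m y)\<close> makes \<open>y\<close> small. In other words, \<open>y\<close> is nearly
  orthogonal to \<open>x\<close> in the \<open>\<ell>\<^sub>2\<close>-sum of the levels.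
\<close>

lemma scaled_products_small:
  assumes \<sigma>: "0 < \<sigma>"
  obtains \<tau> where "0 < \<tau>"
    "\<And>m K y. mixed m y \<le> 1 \<Longrightarrow> norm (comb m y) \<le> \<tau> \<Longrightarrow>
      (\<Sum>k<K. scaled_level i x k * scaled_level m y k) \<le> \<sigma>"
proof -
  define A where "A = (\<Sum>n<i. \<bar>x n\<bar>) + 1"
  have A: "0 < A" unfolding A_def by (intro add_nonneg_pos sum_nonneg) auto
  obtain N where "2 * A / \<sigma> < 2 ^ N" using real_arch_pow[of 2] by force
  then have N: "A * (1 / 2 ^ N) \<le> \<sigma> / 2" using \<sigma> by (simp add: field_simps)
  define \<tau> where "\<tau> = \<sigma> / (2 * A * 2 ^ N)"
  have \<tau>: "0 < \<tau>" using A \<sigma> by (simp add: \<tau>_def)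
  have "(\<Sum>k<K. scaled_level i x k * scaled_level m y k) \<le> \<sigma>"
    if y: "mixed m y \<le> 1" "norm (comb m y) \<le> \<tau>" for m K y
  proof -
    have x_le: "scaled_level i x k \<le> A / 2 ^ Suc k" for k
      by (rule order_trans[OF scaled_level_le_sum divide_right_mono]) (simp_all add: A_def)
    have y_le: "scaled_level m y k \<le> 2 ^ N * \<tau> + (if N \<le> k then 1 else 0)" for k
    proof (cases "N \<le> k")
      case True
      moreover have "0 \<le> 2 ^ N * \<tau>" using \<tau> by simp
      ultimately show ?thesis using scaled_level_le_mixed[of m y k] y(1) by simp
    next
      case False
      have "scaled_level m y k \<le> (4 ^ k * \<tau>) / 2 ^ Suc k"
        unfolding scaled_level_def
        by (intro divide_right_mono order_trans[OF level_le_norm_comb mult_left_mono[OF y(2)]]) simp_all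
      also have "\<dots> = 2 ^ k * \<tau> / 2"
        by (simp add: four_power)
      also have "\<dots> \<le> 2 ^ k * \<tau>" using \<tau> by simp
      also have "\<dots> \<le> 2 ^ N * \<tau>" using False \<tau> by (intro mult_right_mono power_increasing) auto
      finally show ?thesis using False by simp
    qed
    have geo: "(\<Sum>k<K. 1 / 2 ^ Suc k) \<le> (1::real)" for K
    proof -
      have "(\<Sum>k<K. 1 / 2 ^ Suc k) = (1::real) - 1 / 2 ^ K" by (induction K) (auto simp: field_simps)
      then show ?thesis by simp
    qed
    have tail: "(\<Sum>k<K. if N \<le> k then 1 / 2 ^ Suc k else 0) \<le> 1 / (2::real) ^ N" for K
    proof -
      \<comment> \<open>The second summand is the rest of the geometric series.\<close>
      have "(\<Sum>k<K. if N \<le> k then 1 / 2 ^ Suc k else 0) + 1 / 2 ^ max N K \<le> 1 / (2::real) ^ N"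
      proof (induction K)
        case (Suc K)
        show ?case
        proof (cases "N \<le> K")
          case True
          then have "max N (Suc K) = Suc K" "max N K = K" by auto
          then show ?thesis using Suc True by simp
        next
          case False
          then have "max N (Suc K) = N" "max N K = N" by auto
          then show ?thesis using Suc False by simp
        qed
      qed simp
      moreover have "0 \<le> 1 / (2::real) ^ max N K" by simp
      ultimately show ?thesis by linarith
    qed
    have "(\<Sum>k<K. scaled_level i x k * scaled_level m y k)
        \<le> (\<Sum>k<K. A / 2 ^ Suc k * (2 ^ N * \<tau> + (if N \<le> k then 1 else 0)))"
      using A by (intro sum_mono mult_mono x_le y_le scaled_level_nonneg) auto
    also have "\<dots> = (\<Sum>k<K. (A * 2 ^ N * \<tau>) * (1 / 2 ^ Suc k) + A * (if N \<le> k then 1 / 2 ^ Suc k else 0))"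
      by (intro sum.cong refl) (auto simp: field_simps)
    also have "\<dots> = A * 2 ^ N * \<tau> * (\<Sum>k<K. 1 / 2 ^ Suc k)
        + A * (\<Sum>k<K. if N \<le> k then 1 / 2 ^ Suc k else 0)"
      unfolding sum.distrib sum_distrib_left ..
    also have "\<dots> \<le> A * 2 ^ N * \<tau> * 1 + A * (1 / 2 ^ N)"
      using A \<tau> by (intro add_mono mult_left_mono geo tail) auto
    also have "A * 2 ^ N * \<tau> = \<sigma> / 2" using A by (simp add: \<tau>_def)
    finally show ?thesis using N by linarith
  qed
  with \<tau> show thesis by (rule that)
qed

text \<open>
  Suppose the tails of \<open>a\<close> stay above \<open>\<eta>\<close> on the unit ball. Among the \<open>y\<close> in the ball with
  \<open>\<Sum>n. a n * y n \<ge> \<eta>\<close> some have \<open>norm (comb j y)\<close> as small as desired: otherwise the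
  convex set of their combinations is separated from \<open>0\<close> by a positive functional \<open>\<phi>\<close>, but far out,
  where \<open>\<phi> (f n) \<le> 1 / 4 ^ k\<close>, level \<open>k\<close> of such a \<open>y\<close> is at least \<open>4 ^ k * \<phi> (comb j y)\<close> and at
  most \<open>2 ^ Suc k\<close>, which is impossible for large \<open>k\<close> if \<open>\<phi> (comb j y)\<close> stays away from \<open>0\<close>.

  Now let \<open>B\<close> be the norm of \<open>a\<close> and let \<open>x\<close> nearly attain it. Such a \<open>y\<close> is nearly orthogonal
  to \<open>x\<close>, so \<open>\<parallel>x + t y\<parallel>\<^sup>2\<close> is nearly at most \<open>1 + t\<^sup>2\<close>, while \<open>a\<close> is nearly at least \<open>B + t * \<eta>\<close>
  at \<open>x + t y\<close>. As \<open>t\<close> enters the first bound quadratically and the second one linearly, this is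
  absurd for small \<open>t\<close>.
\<close>

lemma functional_tail:
  assumes a: "\<And>n. 0 \<le> a n"
    and bounded: "\<And>m y. (\<And>n. 0 \<le> y n) \<Longrightarrow> (\<Sum>n<m. a n * y n) \<le> L * mixed m y"
    and \<eta>: "0 < \<eta>"
  shows "\<exists>m. \<forall>j y. (\<forall>n. 0 \<le> y n) \<longrightarrow> mixed j y \<le> 1 \<longrightarrow> (\<Sum>n\<in>{m..<j}. a n * y n) \<le> \<eta>"
proof (rule ccontr)
  assume "\<not> ?thesis"
  then have far: "\<exists>j y. (\<forall>n. 0 \<le> y n) \<and> mixed j y \<le> 1 \<and> \<eta> < (\<Sum>n\<in>{m..<j}. a n * y n)" for m
    by (force simp: not_le)
  define V where "V = {\<Sum>n<m. a n * y n | m y. (\<forall>n. 0 \<le> y n) \<and> mixed m y \<le> 1}"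
  define B where "B = Sup V"
  have "v \<le> \<bar>L\<bar>" if "v \<in> V" for v
  proof -
    from that obtain m y where v: "v = (\<Sum>n<m. a n * y n)" "\<And>n. 0 \<le> y n" "mixed m y \<le> 1"
      by (auto simp: V_def)
    have "v \<le> L * mixed m y" unfolding v(1) by (rule bounded[OF v(2)])
    also have "\<dots> \<le> \<bar>L\<bar> * 1" using v(3) mixed_nonneg by (intro mult_mono) auto
    finally show ?thesis by simp
  qed
  then have bdd: "bdd_above V" by (rule bdd_aboveI)
  obtain j0 y0 where y0: "\<forall>n. 0 \<le> y0 n" "mixed j0 y0 \<le> 1" "\<eta> < (\<Sum>n\<in>{0..<j0}. a n * y0 n)"
    using far by blast
  then have V0: "(\<Sum>n<j0. a n * y0 n) \<in> V" by (auto simp: V_def)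
  have B: "\<eta> < B" using y0(3) cSup_upper[OF V0 bdd] by (simp add: B_def lessThan_atLeast0)
  have hom: "(\<Sum>n<m. a n * y n) \<le> B * mixed m y" if y: "\<And>n. 0 \<le> y n" for m y
  proof (cases "mixed m y = 0")
    case True
    then show ?thesis using bounded[where m = m and y = y, OF y] by simp
  next
    case False
    then have pos: "0 < mixed m y" using mixed_nonneg[of m y] by simp
    let ?c = "1 / mixed m y"
    have "(\<Sum>n<m. a n * (?c *\<^sub>R y) n) \<in> V"
      unfolding V_def using y pos by (auto simp: mixed_scale intro!: exI[of _ m] exI[of _ "?c *\<^sub>R y"])
    then have "(\<Sum>n<m. a n * (?c *\<^sub>R y) n) \<le> B" unfolding B_def by (rule cSup_upper[OF _ bdd])
    moreover have "(\<Sum>n<m. a n * (?c *\<^sub>R y) n) = (\<Sum>n<m. a n * y n) / mixed m y"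
      by (simp add: sum_divide_distrib)
    ultimately have "(\<Sum>n<m. a n * y n) / mixed m y \<le> B" by simp
    with pos show ?thesis by (simp only: pos_divide_le_eq)
  qed
  have small: "\<exists>j y. (\<forall>n. 0 \<le> y n) \<and> mixed j y \<le> 1 \<and> \<eta> \<le> (\<Sum>n<j. a n * y n) \<and> norm (comb j y) \<le> \<tau>"
    if \<tau>: "0 < \<tau>" for \<tau>
  proof (rule ccontr)
    assume none: "\<not> ?thesis"
    define D where "D = {comb j y | j y. (\<forall>n. 0 \<le> y n) \<and> mixed j y \<le> 1 \<and> \<eta> \<le> (\<Sum>n<j. a n * y n)}"
    have D0: "comb j0 y0 \<in> D"
      unfolding D_def lessThan_atLeast0
      using y0 by (intro CollectI exI[of _ j0] exI[of _ y0]) simp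
    have "convex D"
    proof (rule convexI)
      fix d e and u v :: real
      assume "d \<in> D" "e \<in> D" and uv: "0 \<le> u" "0 \<le> v" "u + v = 1"
      then obtain i x j y where d: "d = comb i x" "\<And>n. 0 \<le> x n" "mixed i x \<le> 1"
          "\<eta> \<le> (\<Sum>n<i. a n * x n)"
        and e: "e = comb j y" "\<And>n. 0 \<le> y n" "mixed j y \<le> 1" "\<eta> \<le> (\<Sum>n<j. a n * y n)"
        by (auto simp: D_def)
      let ?m = "max i j" and ?z = "u *\<^sub>R cutoff i x + v *\<^sub>R cutoff j y"
      have "comb ?m ?z = u *\<^sub>R d + v *\<^sub>R e"
        using d e uv by (simp add: comb_nonneg_combination comb_cutoff cutoff_apply)
      moreover have "0 \<le> ?z n" for n using d e uv by (simp add: cutoff_apply)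
      moreover have "mixed ?m ?z \<le> 1"
      proof -
        have "mixed ?m ?z \<le> u * mixed i x + v * mixed j y"
          using mixed_triangle[of ?m "u *\<^sub>R cutoff i x" "v *\<^sub>R cutoff j y"] uv
          by (simp add: mixed_scale mixed_cutoff)
        also have "\<dots> \<le> u * 1 + v * 1" using d e uv by (intro add_mono mult_left_mono) auto
        finally show ?thesis using uv by simp
      qed
      moreover have "\<eta> \<le> (\<Sum>n<?m. a n * ?z n)"
      proof -
        have "(\<Sum>n<?m. a n * ?z n)
            = u * (\<Sum>n<?m. a n * cutoff i x n) + v * (\<Sum>n<?m. a n * cutoff j y n)"
          by (simp add: sum_distrib_left algebra_simps flip: sum.distrib)
        also have "\<dots> = u * (\<Sum>n<i. a n * x n) + v * (\<Sum>n<j. a n * y n)" by (simp add: sum_cutoff)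
        also have "\<dots> \<ge> u * \<eta> + v * \<eta>" using d e uv by (intro add_mono mult_left_mono) auto
        finally have "(u + v) * \<eta> \<le> (\<Sum>n<?m. a n * ?z n)" by (simp add: distrib_right)
        then show ?thesis using uv by simp
      qed
      ultimately show "u *\<^sub>R d + v *\<^sub>R e \<in> D" 
        unfolding D_def by (intro CollectI exI[of _ ?m] exI[of _ ?z]) simp
    qed
    moreover have "\<tau> \<le> norm (sup d 0)" if "d \<in> D" for d
    proof -
      from that obtain j y where "d = comb j y" "\<forall>n. 0 \<le> y n" "mixed j y \<le> 1"
        "\<eta> \<le> (\<Sum>n<j. a n * y n)" by (auto simp: D_def)
      moreover from this none have "\<not> norm (comb j y) \<le> \<tau>" by blast
      ultimately show ?thesis using comb_nonneg[of j y] by (simp add: sup_absorb1)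
    qed
    ultimately obtain \<phi> where \<phi>: "linear \<phi>" "\<And>y. \<phi> y \<le> norm (sup y 0)" "\<And>d. d \<in> D \<Longrightarrow> \<tau> \<le> \<phi> d"
      using Mazur_Orlicz[OF sublinear_norm_pos_part, of D \<tau>] D0 by blast
    then have \<phi>': "\<phi> \<in> positive_functionals" by (simp add: positive_functionals_def)
    obtain k where "2 / \<tau> < 2 ^ k" using real_arch_pow[of 2] by force
    then have k: "2 < \<tau> * 2 ^ k" using \<tau> by (simp add: field_simps)
    \<comment> \<open>Far out the truncation in \<open>weight k \<phi>\<close> is not active.\<close>
    have "\<forall>\<^sub>F n in sequentially. \<phi> (f n) < 1 / 4 ^ k"
      using weak[OF \<phi>'] by (rule order_tendstoD) simp
    then obtain m where m: "\<And>n. n \<ge> m \<Longrightarrow> \<phi> (f n) < 1 / 4 ^ k"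
      by (auto simp: eventually_sequentially)
    obtain j y where y: "\<And>n. 0 \<le> y n" "mixed j y \<le> 1" "\<eta> < (\<Sum>n\<in>{m..<j}. a n * y n)"
      using far by blast
    define z where "z = y - cutoff m y"
    have z: "z n = (if n < m then 0 else y n)" for n by (simp add: z_def cutoff_apply)
    have mz: "mixed j z \<le> 1" using mixed_mono[of j z y] y by (force simp: z)
    have "(\<Sum>n<j. a n * z n) = (\<Sum>n\<in>{m..<j}. a n * y n)"
      by (intro sum.mono_neutral_cong_right) (auto simp: z)
    then have "comb j z \<in> D"
      unfolding D_def using y mz by (intro CollectI exI[of _ j] exI[of _ z]) (simp add: z)
    then have "4 ^ k * \<tau> \<le> 4 ^ k * \<phi> (comb j z)" by (intro mult_left_mono \<phi>) auto
    also have "\<dots> = (\<Sum>n<j. 4 ^ k * \<phi> (f n) * \<bar>z n\<bar>)"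
      by (simp add: functional_comb[OF \<phi>'] sum_distrib_left mult.assoc)
    also have "\<dots> = level_sum k j z \<phi>"
      unfolding level_sum_def
    proof (intro sum.cong refl)
      fix n
      show "4 ^ k * \<phi> (f n) * \<bar>z n\<bar> = weight k \<phi> n * \<bar>z n\<bar>"
        using m[of n] by (cases "n < m") (auto simp: z weight_def field_simps)
    qed
    also have "\<dots> \<le> level k j z" by (rule level_upper[OF \<phi>'])
    also have "\<dots> \<le> 2 ^ Suc k * 1"
      by (intro order_trans[OF level_le_mixed mult_left_mono[OF mz]]) simp
    finally have "2 ^ k * (\<tau> * 2 ^ k) \<le> 2 ^ k * 2"
      by (simp add: four_power mult_ac)
    then have "\<tau> * 2 ^ k \<le> 2" by (rule mult_left_le_imp_le) simp
    with k show False by simp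
  qed
  \<comment> \<open>With this \<open>t\<close>, and the errors \<open>t * \<eta> / 4\<close> and \<open>t / 8\<close> below, squaring the two bounds gives
    \<open>B\<^sup>2 + 3 / 2 * \<eta>\<^sup>2 \<le> B\<^sup>2 + 5 / 4 * \<eta>\<^sup>2\<close>.\<close>
  define t where "t = \<eta> / B"
  have Bpos: "0 < B" using B \<eta> by simp
  have t: "0 < t" and tB: "t * B = \<eta>" using \<eta> Bpos by (simp_all add: t_def)
  have "\<exists>v\<in>V. B - t * \<eta> / 4 < v"
    using less_cSup_iff[of V "B - t * \<eta> / 4"] V0 bdd t \<eta> by (auto simp: B_def)
  then obtain i x where x: "\<And>n. 0 \<le> x n" "mixed i x \<le> 1" "B - t * \<eta> / 4 < (\<Sum>n<i. a n * x n)"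
    by (auto simp: V_def)
  obtain \<tau> where \<tau>: "0 < \<tau>" "\<And>m K y. mixed m y \<le> 1 \<Longrightarrow> norm (comb m y) \<le> \<tau> \<Longrightarrow>
      (\<Sum>k<K. scaled_level i x k * scaled_level m y k) \<le> t / 8"
    using scaled_products_small[of "t / 8" i x] t by auto
  obtain j y where y: "\<And>n. 0 \<le> y n" "mixed j y \<le> 1" "\<eta> \<le> (\<Sum>n<j. a n * y n)"
      "norm (comb j y) \<le> \<tau>" using small[OF \<tau>(1)] by blast
  let ?m = "max i j" and ?z = "cutoff i x + t *\<^sub>R cutoff j y"
  have "(\<Sum>n<?m. a n * ?z n) = (\<Sum>n<?m. a n * cutoff i x n) + t * (\<Sum>n<?m. a n * cutoff j y n)"
    by (simp add: sum_distrib_left algebra_simps flip: sum.distrib)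
  also have "\<dots> = (\<Sum>n<i. a n * x n) + t * (\<Sum>n<j. a n * y n)" by (simp add: sum_cutoff)
  also have "\<dots> \<ge> (B - t * \<eta> / 4) + t * \<eta>"
    using x y t by (intro add_mono mult_left_mono) auto
  finally have "(B - t * \<eta> / 4) + t * \<eta> \<le> (\<Sum>n<?m. a n * ?z n)" .
  then have "B + 3 / 4 * (t * \<eta>) \<le> (\<Sum>n<?m. a n * ?z n)" by linarith
  also have "\<dots> \<le> B * mixed ?m ?z" using x y t by (intro hom) (simp add: cutoff_apply)
  finally have low: "B + 3 / 4 * (t * \<eta>) \<le> B * mixed ?m ?z" .
  have up: "(mixed ?m ?z)\<^sup>2 \<le> 1 + t\<^sup>2 + 2 * t * (t / 8)"
    unfolding mixed_sq
  proof (rule suminf_le_const[OF summable_scaled_level])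
    fix K
    have "(\<Sum>k<K. (scaled_level ?m ?z k)\<^sup>2) \<le> (\<Sum>k<K. (scaled_level i x k + t * scaled_level j y k)\<^sup>2)"
    proof (intro sum_mono power_mono scaled_level_nonneg)
      fix k
      have "scaled_level ?m (cutoff i x) k = scaled_level i x k"
        "scaled_level ?m (cutoff j y) k = scaled_level j y k"
        by (simp_all add: scaled_level_def level_cutoff)
      then show "scaled_level ?m ?z k \<le> scaled_level i x k + t * scaled_level j y k"
        using scaled_level_triangle[of ?m "cutoff i x" "t *\<^sub>R cutoff j y" k] t
        by (simp add: scaled_level_scale)
    qed
    also have "\<dots> = (\<Sum>k<K. (scaled_level i x k)\<^sup>2) + t\<^sup>2 * (\<Sum>k<K. (scaled_level j y k)\<^sup>2)
        + 2 * t * (\<Sum>k<K. scaled_level i x k * scaled_level j y k)"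
      unfolding sum_distrib_left sum.distrib[symmetric]
      by (intro sum.cong refl) (simp add: power2_sum power_mult_distrib mult_ac)
    also have "\<dots> \<le> 1 + t\<^sup>2 * 1 + 2 * t * (t / 8)"
    proof (intro add_mono mult_left_mono)
      have le: "(\<Sum>k<K. (scaled_level m w k)\<^sup>2) \<le> 1" if "mixed m w \<le> 1" for m w
      proof -
        have "(\<Sum>k<K. (scaled_level m w k)\<^sup>2) \<le> (mixed m w)\<^sup>2"
          by (rule sum_scaled_level_le) simp
        also have "\<dots> \<le> 1\<^sup>2" using that mixed_nonneg by (rule power_mono)
        finally show ?thesis by simp
      qed
      show "(\<Sum>k<K. (scaled_level i x k)\<^sup>2) \<le> 1" "(\<Sum>k<K. (scaled_level j y k)\<^sup>2) \<le> 1"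
        using le x y by auto
    qed (use \<tau>(2) y t in auto)
    finally show "(\<Sum>k<K. (scaled_level ?m ?z k)\<^sup>2) \<le> 1 + t\<^sup>2 + 2 * t * (t / 8)" by simp
  qed
  have "(B + 3 / 4 * (t * \<eta>))\<^sup>2 \<le> (B * mixed ?m ?z)\<^sup>2"
    using low Bpos t \<eta> by (intro power_mono) auto
  also have "\<dots> \<le> B\<^sup>2 * (1 + t\<^sup>2 + 2 * t * (t / 8))"
    unfolding power_mult_distrib by (intro mult_left_mono up) simp
  also have "\<dots> = B\<^sup>2 + 5 / 4 * (t * B)\<^sup>2" by (simp add: power2_eq_square algebra_simps)
  also have "(B + 3 / 4 * (t * \<eta>))\<^sup>2 = B\<^sup>2 + 3 / 2 * ((t * B) * \<eta>) + (3 / 4 * (t * \<eta>))\<^sup>2"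
    by (simp add: power2_eq_square algebra_simps)
  finally have "3 / 2 * ((t * B) * \<eta>) + (3 / 4 * (t * \<eta>))\<^sup>2 \<le> 5 / 4 * (t * B)\<^sup>2" by simp
  then have "3 / 2 * (\<eta> * \<eta>) + (3 / 4 * (t * \<eta>))\<^sup>2 \<le> 5 / 4 * (\<eta> * \<eta>)"
    by (simp only: tB power2_eq_square[of \<eta>])
  moreover have "0 < \<eta> * \<eta>" using \<eta> by simp
  moreover have "0 \<le> (3 / 4 * (t * \<eta>))\<^sup>2" by simp
  ultimately show False by linarith
qed

end

section \<open>The reflexive lattice\<close>

lemma sum_half_powers_le: "(\<Sum>n\<in>{1..<m}. 1 / 2 ^ n) \<le> (1::real)"
proof (cases m)
  case (Suc j)
  have "(\<Sum>n\<in>{1..<Suc j}. 1 / 2 ^ n) = (1::real) - 1 / 2 ^ j"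
    by (induction j) (auto simp: field_simps)
  then show ?thesis using Suc by simp
qed simp

context weakly_null_sequence
begin

text \<open>
  The norm of the image of the modulus under the operator, enlarged by a term that is positive for every vector with a
  nonzero coordinate beyond \<open>0\<close> but tends to \<open>0\<close> along the unit sequences. It keeps the operator
  from attaining its norm without lowering that norm.
\<close>

definition perturbed :: "nat \<Rightarrow> (nat \<Rightarrow> real) \<Rightarrow> real"
  where "perturbed m x = norm (comb m x) + (\<Sum>n\<in>{1..<m}. \<bar>x n\<bar> / 2 ^ n)"

text \<open>
  The first entry adds a copy of the reals on which the operator vanishes. Because the summands are
  joined by the maximum, adding \<open>unit_seq 0\<close> to vectors of norm one supported on the other coordinates
  keeps their norm and prevents them from being weakly null.
\<close>

definition combined :: "nat \<Rightarrow> (nat \<Rightarrow> real) \<Rightarrow> real"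
  where "combined m x = max (if m = 0 then 0 else \<bar>x 0\<bar>) (max (mixed m x) (perturbed m x))"

lemma comb_mono: "(\<And>n. n < m \<Longrightarrow> \<bar>x n\<bar> \<le> \<bar>y n\<bar>) \<Longrightarrow> comb m x \<le> comb m y"
  unfolding comb_def by (intro sum_mono scaleR_right_mono f_nonneg) auto

lemma comb_triangle: "comb m (x + y) \<le> comb m x + comb m y"
  unfolding comb_def sum.distrib[symmetric] scaleR_left_distrib[symmetric]
  by (intro sum_mono scaleR_right_mono f_nonneg) auto

lemma comb_scale: "comb m (c *\<^sub>R x) = \<bar>c\<bar> *\<^sub>R comb m x"
  by (simp add: comb_def scaleR_sum_right abs_mult)

lemma perturbed_triangle: "perturbed m (x + y) \<le> perturbed m x + perturbed m y"
proof -
  have "norm (comb m (x + y)) \<le> norm (comb m x + comb m y)"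
    by (intro norm_mono_pos comb_nonneg comb_triangle)
  also have "\<dots> \<le> norm (comb m x) + norm (comb m y)" by (rule norm_triangle_ineq)
  finally have "norm (comb m (x + y)) \<le> norm (comb m x) + norm (comb m y)" .
  moreover have "(\<Sum>n\<in>{1..<m}. \<bar>(x + y) n\<bar> / 2 ^ n)
      \<le> (\<Sum>n\<in>{1..<m}. \<bar>x n\<bar> / 2 ^ n) + (\<Sum>n\<in>{1..<m}. \<bar>y n\<bar> / 2 ^ n)"
    unfolding sum.distrib[symmetric] add_divide_distrib[symmetric]
    by (intro sum_mono divide_right_mono) auto
  ultimately show ?thesis unfolding perturbed_def by linarith
qed

lemma perturbed_scale: "perturbed m (c *\<^sub>R x) = \<bar>c\<bar> * perturbed m x"
  by (simp add: perturbed_def comb_scale distrib_left sum_distrib_left abs_mult)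

lemma perturbed_mono: "(\<And>n. n < m \<Longrightarrow> \<bar>x n\<bar> \<le> \<bar>y n\<bar>) \<Longrightarrow> perturbed m x \<le> perturbed m y"
  unfolding perturbed_def
  by (intro add_mono sum_mono divide_right_mono norm_mono_pos comb_nonneg comb_mono) auto

lemma perturbed_cutoff: "j \<le> m \<Longrightarrow> perturbed m (cutoff j x) = perturbed j x"
  unfolding perturbed_def
  by (intro arg_cong2[where f = "(+)"] sum.mono_neutral_cong_right)
    (auto simp: comb_cutoff cutoff_apply)

lemma coordinate_le_perturbed: "1 \<le> n \<Longrightarrow> n < m \<Longrightarrow> norm (comb m x) + \<bar>x n\<bar> / 2 ^ n \<le> perturbed m x"
  unfolding perturbed_def
  by (intro add_left_mono member_le_sum[where f = "\<lambda>n. \<bar>x n\<bar> / 2 ^ n"]) auto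

lemma mixed_le_combined: "mixed m x \<le> combined m x"
  and perturbed_le_combined: "perturbed m x \<le> combined m x"
  by (auto simp: combined_def)

lemma combined_triangle: "combined m (x + y) \<le> combined m x + combined m y"
proof -
  have 0: "(if m = 0 then 0 else \<bar>z 0\<bar>) \<le> combined m z" for z by (simp add: combined_def)
  have "(if m = 0 then 0 else \<bar>(x + y) 0\<bar>) \<le> combined m x + combined m y"
    using 0[of x] 0[of y] by (auto split: if_splits)
  moreover have "mixed m (x + y) \<le> combined m x + combined m y"
    using mixed_triangle[of m x y] mixed_le_combined[of m x] mixed_le_combined[of m y] by linarith
  moreover have "perturbed m (x + y) \<le> combined m x + combined m y"
    using perturbed_triangle[of m x y] perturbed_le_combined[of m x] perturbed_le_combined[of m y]
    by linarith
  ultimately show ?thesis unfolding combined_def[of m "x + y"] by simp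
qed

sublocale lattice_seminorms combined "\<lambda>n. 2 ^ n"
proof
  fix m j n :: nat and x y :: "nat \<Rightarrow> real" and c :: real
  show "combined m (x + y) \<le> combined m x + combined m y" by (rule combined_triangle)
  show "combined m (c *\<^sub>R x) = \<bar>c\<bar> * combined m x"
    by (simp add: combined_def mixed_scale perturbed_scale abs_mult max_mult_distrib_left)
  show "combined m x \<le> combined m y" if "\<And>n. n < m \<Longrightarrow> \<bar>x n\<bar> \<le> \<bar>y n\<bar>"
    unfolding combined_def using that by (intro max.mono mixed_mono perturbed_mono) auto
  show "combined m (cutoff j x) = combined j x" if "j \<le> m"
    using that by (auto simp: combined_def mixed_cutoff perturbed_cutoff cutoff_apply)
  show "\<bar>x n\<bar> \<le> 2 ^ n * combined m x" if "n < m"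
  proof (cases "n = 0")
    case True
    then show ?thesis using that by (simp add: combined_def)
  next
    case False
    then have "norm (comb m x) + \<bar>x n\<bar> / 2 ^ n \<le> perturbed m x"
      using that by (intro coordinate_le_perturbed) auto
    then have "\<bar>x n\<bar> / 2 ^ n \<le> combined m x"
      using perturbed_le_combined[of m x] norm_ge_zero[of "comb m x"] by linarith
    then show ?thesis by (simp add: field_simps)
  qed
qed

text \<open>
  Apart from the coordinate \<open>0\<close>, the combined norm is equivalent to the mixed norm, so it inherits
  the behaviour of tails.
\<close>

lemma combined_le_mixed:
  assumes "x 0 = 0"
  shows "combined m x \<le> 4 * mixed m x"
proof -
  have "(\<Sum>n\<in>{1..<m}. \<bar>x n\<bar> / 2 ^ n) \<le> (\<Sum>n\<in>{1..<m}. level 0 m x * (1 / 2 ^ n))"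
    by (intro sum_mono) (simp add: divide_right_mono coordinate_le_level)
  also have "\<dots> \<le> level 0 m x * 1"
    unfolding sum_distrib_left[symmetric] by (intro mult_left_mono sum_half_powers_le level_nonneg)
  finally have "perturbed m x \<le> 2 * level 0 m x"
    using norm_comb_le_level[of m x] by (simp add: perturbed_def)
  then have "perturbed m x \<le> 4 * mixed m x" using level_le_mixed[of 0 m x] by simp
  then show ?thesis using assms by (simp add: combined_def mixed_nonneg)
qed

lemma mixed_le_seq_norm: "x \<in> bounded_seqs \<Longrightarrow> mixed m x \<le> seq_norm x"
  using order_trans[OF mixed_le_combined r_le_seq_norm] .

lemma eventually_tail_small:
  assumes "x \<in> bounded_seqs" "0 < \<epsilon>"
  shows "\<forall>\<^sub>F m in sequentially. \<forall>j. mixed j (x - cutoff m x) \<le> \<epsilon>"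
  using mixed_tail[OF mixed_le_seq_norm[OF assms(1)] assms(2)] .

lemma seq_norm_tail:
  assumes x: "x \<in> bounded_seqs"
  shows "(\<lambda>m. seq_norm (x - cutoff m x)) \<longlonglongrightarrow> 0"
proof (rule order_tendstoI)
  fix e :: real assume "e < 0"
  then show "\<forall>\<^sub>F m in sequentially. e < seq_norm (x - cutoff m x)"
    using seq_norm_nonneg[OF bounded_seqs_diff[OF x cutoff_bounded_seqs]]
    by (auto intro: always_eventually less_le_trans)
next
  fix e :: real assume e: "0 < e"
  then have "0 < e / 8" by simp
  from eventually_tail_small[OF x this] eventually_ge_at_top[of 1]
  show "\<forall>\<^sub>F m in sequentially. seq_norm (x - cutoff m x) < e"
  proof eventually_elim
    case (elim m)
    have "combined j (x - cutoff m x) \<le> e / 2" for j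
      using combined_le_mixed[of "x - cutoff m x" j] elim(1)[rule_format, of j] elim(2)
      by (simp add: cutoff_apply)
    then have "seq_norm (x - cutoff m x) \<le> e / 2" by (rule seq_norm_le)
    then show ?case using e by simp
  qed
qed

text \<open>
  The absolute values of the coefficients of a bounded functional, away from the coordinate \<open>0\<close>,
  satisfy the hypotheses of \<open>functional_tail\<close>.
\<close>

theorem reflexive_seq_lattice: "reflexive_on seq_lattice"
proof (rule reflexive_on_seq_lattice)
  fix g :: "(nat \<Rightarrow> real) \<Rightarrow> real" and \<epsilon> :: real
  assume g: "bounded_linear_on seq_lattice g" and \<epsilon>: "0 < \<epsilon>"
  obtain K0 where K0: "\<forall>x\<in>bounded_seqs. \<bar>g x\<bar> \<le> K0 * seq_norm x"
    using g by (auto simp: bounded_linear_on_def)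
  define K where "K = \<bar>K0\<bar>"
  have K: "\<bar>g x\<bar> \<le> K * seq_norm x" if "x \<in> bounded_seqs" for x
  proof -
    have "\<bar>g x\<bar> \<le> K0 * seq_norm x" using K0 that by blast
    also have "\<dots> \<le> K * seq_norm x"
      unfolding K_def by (intro mult_right_mono seq_norm_nonneg that) simp
    finally show ?thesis .
  qed
  have g_add: "g (x + y) = g x + g y" if "x \<in> bounded_seqs" "y \<in> bounded_seqs" for x y
    using g that by (simp add: bounded_linear_on_def)
  have g_diff: "g (x - y) = g x - g y" if "x \<in> bounded_seqs" "y \<in> bounded_seqs" for x y
    using g_add[OF bounded_seqs_diff[OF that] that(2)] by simp
  define a where "a n = (if n = 0 then 0 else \<bar>g (unit_seq n)\<bar>)" for n
  have "(\<Sum>n<m. a n * y n) \<le> (4 * K) * mixed m y" if y: "\<And>n. 0 \<le> y n" for m y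
  proof -
    define z where "z n = (if n = 0 then 0 else sgn (g (unit_seq n)) * y n)" for n
    have "(\<Sum>n<m. a n * y n) = g (cutoff m z)"
      unfolding bounded_linear_on_cutoff[OF g]
      by (intro sum.cong refl) (auto simp: a_def z_def abs_sgn mult_ac)
    also have "\<dots> \<le> K * seq_norm (cutoff m z)"
      using K[OF cutoff_bounded_seqs, of m z] by simp
    also have "seq_norm (cutoff m z) = combined m z"
      using seq_norm_beyond(2)[of m "cutoff m z"] by (simp add: cutoff_apply r_cutoff)
    also have "K * combined m z \<le> K * (4 * mixed m z)"
      by (intro mult_left_mono combined_le_mixed) (auto simp: z_def K_def)
    also have "\<dots> \<le> K * (4 * mixed m y)"
      using y by (intro mult_left_mono mixed_mono) (auto simp: z_def K_def abs_mult sgn_if)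
    finally show ?thesis by simp
  qed
  moreover have "0 \<le> a n" for n by (simp add: a_def)
  ultimately obtain m0 where "\<forall>j y. (\<forall>n. 0 \<le> y n) \<longrightarrow> mixed j y \<le> 1 \<longrightarrow>
      (\<Sum>n\<in>{m0..<j}. a n * y n) \<le> \<epsilon>"
    using functional_tail[OF _ _ \<epsilon>, of a "4 * K"] by blast
  then have m0: "(\<Sum>n\<in>{m0..<j}. a n * y n) \<le> \<epsilon>"
    if "\<And>n. 0 \<le> y n" "mixed j y \<le> 1" for j y
    using that by blast
  \<comment> \<open>The coordinate \<open>0\<close> is invisible to \<open>a\<close>, so the cut has to come after it.\<close>
  define m where "m = Suc m0"
  show "\<exists>m. \<forall>x\<in>bounded_seqs. seq_norm x \<le> 1 \<longrightarrow> \<bar>g (x - cutoff m x)\<bar> \<le> \<epsilon>"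
  proof (intro exI[of _ m] ballI impI)
    fix x assume x: "x \<in> bounded_seqs" and le1: "seq_norm x \<le> 1"
    have "(\<lambda>j. g (x - cutoff j x)) \<longlonglongrightarrow> 0"
    proof (rule Lim_null_comparison)
      show "\<forall>\<^sub>F j in sequentially. norm (g (x - cutoff j x)) \<le> K * seq_norm (x - cutoff j x)"
        using K[OF bounded_seqs_diff[OF x cutoff_bounded_seqs]] by simp
      show "(\<lambda>j. K * seq_norm (x - cutoff j x)) \<longlonglongrightarrow> 0"
        using tendsto_mult_left[OF seq_norm_tail[OF x], of K] by simp
    qed
    then have "(\<lambda>j. g x - g (cutoff m x) - g (x - cutoff j x)) \<longlonglongrightarrow> g x - g (cutoff m x) - 0"
      by (intro tendsto_intros)
    then have lim: "(\<lambda>j. \<bar>g (cutoff j x) - g (cutoff m x)\<bar>) \<longlonglongrightarrow> \<bar>g (x - cutoff m x)\<bar>"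
      by (intro tendsto_rabs) (simp add: g_diff x cutoff_bounded_seqs)
    show "\<bar>g (x - cutoff m x)\<bar> \<le> \<epsilon>"
    proof (rule LIMSEQ_le_const2[OF lim], intro exI[of _ m] allI impI)
      fix j assume mj: "m \<le> j"
      have "g (cutoff j x) - g (cutoff m x) = (\<Sum>n\<in>{m..<j}. x n * g (unit_seq n))"
        using sum_diff_nat_ivl[of 0 m j "\<lambda>n. x n * g (unit_seq n)"] mj
        by (simp add: bounded_linear_on_cutoff[OF g] lessThan_atLeast0)
      also have "\<bar>\<dots>\<bar> \<le> (\<Sum>n\<in>{m..<j}. a n * \<bar>x n\<bar>)"
        by (intro order_trans[OF sum_abs] sum_mono) (auto simp: a_def abs_mult m_def)
      also have "\<dots> \<le> (\<Sum>n\<in>{m0..<j}. a n * \<bar>x n\<bar>)"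
        by (intro sum_mono2) (auto simp: m_def a_def)
      also have "\<dots> \<le> \<epsilon>"
      proof (rule m0)
        have "mixed j (\<lambda>n. \<bar>x n\<bar>) \<le> mixed j x" by (rule mixed_mono) simp
        then show "mixed j (\<lambda>n. \<bar>x n\<bar>) \<le> 1" using mixed_le_seq_norm[OF x, of j] le1 by linarith
      qed simp
      finally show "\<bar>g (cutoff j x) - g (cutoff m x)\<bar> \<le> \<epsilon>" .
    qed
  qed
qed

section \<open>A positive operator that does not attain its norm\<close>

definition synthesis :: "(nat \<Rightarrow> real) \<Rightarrow> 'f"
  where "synthesis x = (\<Sum>n. x n *\<^sub>R f n)"

lemma norm_sum_le_comb: "norm (\<Sum>n<m. x n *\<^sub>R f n) \<le> norm (comb m x)"
proof (rule norm_le_of_modulus_le)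
  show "(\<Sum>n<m. x n *\<^sub>R f n) \<le> comb m x"
    unfolding comb_def by (intro sum_mono scaleR_right_mono f_nonneg) auto
  have "- (\<Sum>n<m. x n *\<^sub>R f n) = (\<Sum>n<m. (- x n) *\<^sub>R f n)" by (simp add: sum_negf)
  also have "\<dots> \<le> comb m x"
    unfolding comb_def by (intro sum_mono scaleR_right_mono f_nonneg) auto
  finally show "- (\<Sum>n<m. x n *\<^sub>R f n) \<le> comb m x" .
qed

lemma summable_synthesis:
  assumes x: "x \<in> bounded_seqs"
  shows "summable (\<lambda>n. x n *\<^sub>R f n)"
  unfolding summable_Cauchy
proof (intro allI impI)
  fix e :: real assume e: "0 < e"
  then have "0 < e / 4" by simp
  then obtain N where N: "\<And>m j. N \<le> m \<Longrightarrow> mixed j (x - cutoff m x) \<le> e / 4"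
    using eventually_tail_small[OF x] unfolding eventually_sequentially by meson
  have "norm (\<Sum>n\<in>{m..<j}. x n *\<^sub>R f n) < e" if "N \<le> m" for m j
  proof -
    have "(\<Sum>n\<in>{m..<j}. x n *\<^sub>R f n) = (\<Sum>n<j. (x - cutoff m x) n *\<^sub>R f n)"
      by (intro sum.mono_neutral_cong_left) (auto simp: cutoff_apply)
    also have "norm \<dots> \<le> level 0 j (x - cutoff m x)"
      by (rule order_trans[OF norm_sum_le_comb norm_comb_le_level])
    also have "\<dots> \<le> 2 * (e / 4)"
      using level_le_mixed[of 0 j "x - cutoff m x"] N[OF that, of j] by simp
    also have "\<dots> < e" using e by simp
    finally show ?thesis .
  qed
  then show "\<exists>N. \<forall>m\<ge>N. \<forall>n. norm (\<Sum>n\<in>{m..<n}. x n *\<^sub>R f n) < e" by blast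
qed

lemma synthesis_tendsto: "x \<in> bounded_seqs \<Longrightarrow> (\<lambda>m. \<Sum>n<m. x n *\<^sub>R f n) \<longlonglongrightarrow> synthesis x"
  unfolding synthesis_def by (rule summable_LIMSEQ[OF summable_synthesis])

lemma norm_synthesis_le: "x \<in> bounded_seqs \<Longrightarrow> norm (synthesis x) \<le> seq_norm x"
proof (rule LIMSEQ_le_const2[OF tendsto_norm[OF synthesis_tendsto]], assumption, intro exI allI impI)
  fix m assume x: "x \<in> bounded_seqs"
  have "norm (comb m x) \<le> perturbed m x" by (simp add: perturbed_def sum_nonneg)
  then show "norm (\<Sum>n<m. x n *\<^sub>R f n) \<le> seq_norm x"
    using norm_sum_le_comb[where m = m and x = x] perturbed_le_combined[of m x] r_le_seq_norm[OF x, of m] by linarith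
qed

lemma norm_synthesis_less:
  assumes x: "x \<in> bounded_seqs" and n: "1 \<le> n" "x n \<noteq> 0"
  shows "norm (synthesis x) < seq_norm x"
proof -
  have "norm (synthesis x) \<le> seq_norm x - \<bar>x n\<bar> / 2 ^ n"
  proof (rule LIMSEQ_le_const2[OF tendsto_norm[OF synthesis_tendsto[OF x]]],
      intro exI[of _ "Suc n"] allI impI)
    fix m assume "Suc n \<le> m"
    then have "norm (comb m x) + \<bar>x n\<bar> / 2 ^ n \<le> perturbed m x"
      using n by (intro coordinate_le_perturbed) auto
    then show "norm (\<Sum>n<m. x n *\<^sub>R f n) \<le> seq_norm x - \<bar>x n\<bar> / 2 ^ n"
      using norm_sum_le_comb[where m = m and x = x] perturbed_le_combined[of m x] r_le_seq_norm[OF x, of m] by linarith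
  qed
  moreover have "0 < \<bar>x n\<bar> / 2 ^ n" using n by simp
  ultimately show ?thesis by linarith
qed

lemma synthesis_add:
  "x \<in> bounded_seqs \<Longrightarrow> y \<in> bounded_seqs \<Longrightarrow> synthesis (x + y) = synthesis x + synthesis y"
  unfolding synthesis_def by (simp add: scaleR_left_distrib suminf_add summable_synthesis)

lemma synthesis_scaleR: "x \<in> bounded_seqs \<Longrightarrow> synthesis (c *\<^sub>R x) = c *\<^sub>R synthesis x"
  unfolding synthesis_def
  using suminf_scaleR_right[OF summable_synthesis, of x c] by simp

lemma synthesis_unit: "synthesis (unit_seq n) = f n"
  unfolding synthesis_def
  by (subst suminf_finite[of "{n}"]) (auto simp: unit_seq_def)

lemma positive_operator_synthesis: "positive_operator_on seq_lattice synthesis"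
  unfolding positive_operator_on_def bounded_linear_on_def
proof (intro conjI ballI allI impI)
  show "\<exists>K. \<forall>x\<in>carr seq_lattice. norm (synthesis x) \<le> K * nrm seq_lattice x"
    using norm_synthesis_le by (intro exI[of _ 1]) simp
  show "0 \<le> synthesis x" if x: "(0, x) \<in> leq seq_lattice" for x
    using x by (intro nonneg_limit[OF synthesis_tendsto])
      (auto intro!: sum_nonneg scaleR_nonneg_nonneg f_nonneg)
qed (simp_all add: synthesis_add synthesis_scaleR)

text \<open>The multiple of \<open>unit_seq (Suc n)\<close> that has perturbed norm \<open>1\<close>.\<close>

definition spike :: "nat \<Rightarrow> real"
  where "spike n = 1 / (1 + 1 / 2 ^ Suc n)"

definition maximizer :: "nat \<Rightarrow> nat \<Rightarrow> real"
  where "maximizer n = unit_seq 0 + spike n *\<^sub>R unit_seq (Suc n)"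

lemma spike_bounds: "0 < spike n" "spike n \<le> 1"
proof -
  have pos: "0 < 1 + 1 / (2::real) ^ Suc n" by (intro add_pos_pos) auto
  then show "0 < spike n" by (simp add: spike_def)
  show "spike n \<le> 1" unfolding spike_def pos_divide_le_eq[OF pos] by simp
qed

lemma spike_tendsto: "spike \<longlonglongrightarrow> 1"
proof -
  have "(\<lambda>n. 1 / (2::real) ^ n) \<longlonglongrightarrow> 0"
    using LIMSEQ_power_zero[of "1 / 2 :: real"] by (simp add: power_one_over)
  then have "(\<lambda>n. 1 / (2::real) ^ Suc n) \<longlonglongrightarrow> 0" by (rule LIMSEQ_Suc)
  then have "(\<lambda>n. 1 / (1 + 1 / (2::real) ^ Suc n)) \<longlonglongrightarrow> 1 / (1 + 0)"
    by (intro tendsto_intros) auto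
  then show ?thesis by (simp add: spike_def[abs_def])
qed

lemma maximizer_apply:
  "maximizer n i = (if i = 0 then 1 else if i = Suc n then spike n else 0)"
  by (simp add: maximizer_def unit_seq_def)

lemma mixed_unit_0: "mixed m (unit_seq 0) = 0"
proof -
  have "level_sum k m (unit_seq 0) \<phi> = 0" if "\<phi> \<in> positive_functionals" for k \<phi>
    unfolding level_sum_def
    by (intro sum.neutral) (auto simp: unit_seq_def weight_def f_0
        linear_0[OF positive_functionals_linear[OF that]])
  then have "level k m (unit_seq 0) \<le> 0" for k by (intro level_least) simp
  then have "level k m (unit_seq 0) = 0" for k using level_nonneg antisym by blast
  then show ?thesis by (simp add: mixed_def scaled_level_def)
qed

lemma maximizer_norm:
  shows maximizer_bounded_seqs: "maximizer n \<in> bounded_seqs"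
    and seq_norm_maximizer: "seq_norm (maximizer n) = 1"
proof -
  let ?j = "Suc (Suc n)"
  have van: "maximizer n i = 0" if "?j \<le> i" for i using that by (simp add: maximizer_apply)
  show "maximizer n \<in> bounded_seqs" using van by (rule seq_norm_beyond(1))
  have "mixed ?j (maximizer n) \<le> mixed ?j (unit_seq 0) + mixed ?j (spike n *\<^sub>R unit_seq (Suc n))"
    unfolding maximizer_def by (rule mixed_triangle)
  also have "\<dots> = spike n * mixed ?j (unit_seq (Suc n))"
    using spike_bounds[of n] by (simp add: mixed_unit_0 mixed_scale)
  also have "\<dots> \<le> 1 * 1" using spike_bounds[of n] mixed_nonneg by (intro mult_mono mixed_unit_le) auto
  finally have m: "mixed ?j (maximizer n) \<le> 1" by simp
  have "comb ?j (maximizer n) = (\<Sum>i<?j. if i = Suc n then spike n *\<^sub>R f i else 0)"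
    unfolding comb_def using spike_bounds[of n]
    by (intro sum.cong refl) (auto simp: maximizer_apply f_0)
  then have c: "norm (comb ?j (maximizer n)) = spike n"
    using spike_bounds[of n] norm_f[of "Suc n"] by simp
  have "(\<Sum>i\<in>{1..<?j}. \<bar>maximizer n i\<bar> / 2 ^ i) = (\<Sum>i\<in>{1..<?j}. if i = Suc n then spike n / 2 ^ i else 0)"
    using spike_bounds[of n] by (intro sum.cong refl) (auto simp: maximizer_apply)
  then have "perturbed ?j (maximizer n) = spike n * (1 + 1 / 2 ^ Suc n)"
    by (simp add: perturbed_def c distrib_left)
  also have "\<dots> = 1"
  proof -
    have "0 < 1 + 1 / (2::real) ^ Suc n" by (intro add_pos_pos) auto
    then show ?thesis unfolding spike_def by simp
  qed
  finally have p: "perturbed ?j (maximizer n) = 1" .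
  have "seq_norm (maximizer n) = combined ?j (maximizer n)" using van by (rule seq_norm_beyond(2))
  also have "\<dots> = 1" using m p by (simp add: combined_def maximizer_apply)
  finally show "seq_norm (maximizer n) = 1" .
qed

lemma norm_synthesis_maximizer: "norm (synthesis (maximizer n)) = spike n"
  using spike_bounds[of n] norm_f[of "Suc n"]
  by (simp add: maximizer_def synthesis_add synthesis_scaleR synthesis_unit unit_seq_bounded_seqs
      bounded_seqs_scaleR f_0)

lemma opnorm_synthesis: "opnorm seq_lattice synthesis = 1"
proof (rule antisym)
  show "opnorm seq_lattice synthesis \<le> 1"
    by (rule opnorm_le) (rule order_trans[OF norm_synthesis_le])
  have "bounded_linear_on seq_lattice synthesis"
    using positive_operator_synthesis by (simp add: positive_operator_on_def)
  then have "spike n \<le> opnorm seq_lattice synthesis" for n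
    using le_opnorm[of synthesis "maximizer n"] maximizer_norm norm_synthesis_maximizer by simp
  then show "1 \<le> opnorm seq_lattice synthesis" by (intro LIMSEQ_le_const2[OF spike_tendsto]) auto
qed

theorem not_positive_WMP_seq_lattice: "\<not> positive_WMP seq_lattice TYPE('f)"
proof
  assume WMP: "positive_WMP seq_lattice TYPE('f)"
  have "maximizing_seq_on seq_lattice synthesis maximizer"
    unfolding maximizing_seq_on_def
    by (simp add: maximizer_bounded_seqs seq_norm_maximizer norm_synthesis_maximizer
        opnorm_synthesis spike_tendsto)
  moreover have "(0, maximizer n) \<in> leq seq_lattice" for n
    using spike_bounds[of n] bounded_seqsI[of 0 0] by (simp add: maximizer_bounded_seqs maximizer_apply)
  moreover have "\<not> weakly_null_on seq_lattice maximizer"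
  proof
    assume "weakly_null_on seq_lattice maximizer"
    then have "(\<lambda>n. coordinate 0 (maximizer n)) \<longlonglongrightarrow> 0"
      using coordinate_in_dual by (auto simp: weakly_null_on_def)
    then show False
      by (simp add: coordinate_def maximizer_bounded_seqs maximizer_apply LIMSEQ_const_iff)
  qed
  ultimately have "norm_attaining_on seq_lattice synthesis"
    using WMP positive_operator_synthesis unfolding positive_WMP_def by blast
  then obtain x where x: "x \<in> bounded_seqs" "seq_norm x \<le> 1" "norm (synthesis x) = 1"
    by (auto simp: norm_attaining_on_def opnorm_synthesis)
  show False
  proof (cases "\<exists>n\<ge>1. x n \<noteq> 0")
    case True
    then show False using norm_synthesis_less[of x] x by fastforce
  next
    case False
    then have "x n *\<^sub>R f n = 0" for n by (cases n) (auto simp: f_0)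
    then have "synthesis x = 0" by (simp only: synthesis_def suminf_zero)
    then show False using x by simp
  qed
qed

end

text \<open>
  A positive weakly null sequence that is not norm null has a subsequence with norms bounded away
  from \<open>0\<close>, and normalizing that one keeps it weakly null.
\<close>

lemma ex_weakly_null_sequence:
  assumes "\<not> positive_Schur_property TYPE('f::banach_lattice)"
  shows "\<exists>f :: nat \<Rightarrow> 'f. weakly_null_sequence f"
proof -
  obtain x :: "nat \<Rightarrow> 'f" where x: "\<And>n. 0 \<le> x n" "weakly_null x" "\<not> x \<longlonglongrightarrow> 0"
    using assms by (auto simp: positive_Schur_property_def)
  then obtain \<epsilon> where \<epsilon>: "0 < \<epsilon>" "\<forall>N. \<exists>n\<ge>N. \<epsilon> \<le> norm (x n)"
    by (auto simp: LIMSEQ_iff not_less)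
  then obtain \<sigma> where \<sigma>: "\<And>N. N \<le> \<sigma> N" "\<And>N. \<epsilon> \<le> norm (x (\<sigma> N))" by metis
  define f where "f n = (if n = 0 then 0 else (1 / norm (x (\<sigma> n))) *\<^sub>R x (\<sigma> n))" for n
  have pos: "0 < norm (x (\<sigma> n))" for n using \<epsilon>(1) \<sigma>(2)[of n] by linarith
  have "weakly_null_sequence f"
  proof
    show "f 0 = 0" by (simp add: f_def)
    show "0 \<le> f n" for n using x(1) by (simp add: f_def scaleR_nonneg_nonneg)
    show "norm (f n) = 1" if "1 \<le> n" for n using that pos[of n] by (simp add: f_def)
    fix \<phi> :: "'f \<Rightarrow> real" assume \<phi>: "\<phi> \<in> positive_functionals"
    have "filterlim \<sigma> sequentially sequentially"
      using filterlim_at_top_mono[OF filterlim_ident, of \<sigma>] \<sigma>(1) by simp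
    then have lim: "(\<lambda>n. \<phi> (x (\<sigma> n))) \<longlonglongrightarrow> 0"
      by (rule filterlim_compose[OF positive_functionals_weakly_null[OF x(2) \<phi>]])
    show "(\<lambda>n. \<phi> (f n)) \<longlonglongrightarrow> 0"
    proof (rule Lim_null_comparison)
      show "(\<lambda>n. \<phi> (x (\<sigma> n)) / \<epsilon>) \<longlonglongrightarrow> 0"
        using tendsto_divide[OF lim tendsto_const, of \<epsilon>] \<epsilon>(1) by simp
      have nn: "0 \<le> \<phi> (x (\<sigma> n))" for n using positive_functionals_nonneg[OF \<phi> x(1)] .
      have "norm (\<phi> (f n)) \<le> \<phi> (x (\<sigma> n)) / \<epsilon>" for n
      proof -
        have "norm (\<phi> (f n)) \<le> \<phi> (x (\<sigma> n)) / norm (x (\<sigma> n))"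
          using nn by (simp add: f_def linear_0[OF positive_functionals_linear[OF \<phi>]]
              linear_scale[OF positive_functionals_linear[OF \<phi>]])
        also have "\<dots> \<le> \<phi> (x (\<sigma> n)) / \<epsilon>"
          using nn \<epsilon>(1) \<sigma>(2) pos by (intro divide_left_mono) auto
        finally show ?thesis .
      qed
      then show "\<forall>\<^sub>F n in sequentially. norm (\<phi> (f n)) \<le> \<phi> (x (\<sigma> n)) / \<epsilon>" by simp
    qed
  qed
  then show ?thesis by blast
qed

theorem theorem3p8:
  assumes "order_continuous_norm TYPE('f::banach_lattice)"
    and "\<not> positive_Schur_property TYPE('f)"
  shows "\<exists>E :: (nat \<Rightarrow> real) nlattice.
    banach_lattice_on E \<and> reflexive_on E \<and> \<not> positive_WMP E TYPE('f)"
proof -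
  obtain f :: "nat \<Rightarrow> 'f" where "weakly_null_sequence f"
    using ex_weakly_null_sequence[OF assms(2)] by blast
  then interpret weakly_null_sequence f .
  show ?thesis
    using banach_lattice_on_seq_lattice reflexive_seq_lattice not_positive_WMP_seq_lattice by blast
qed

end
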